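(* Let $N,c\in\mathbb N$. For every XOR game $G$ with $N$ inputs per player: (a) $\omega_c^{1}(G)\le K_G\,2^{c/2}\,\omega(G)$; (b) $\omega_c^{1}(G)\ge \dfrac{2^{c/2}}{K_G\sqrt N}$. Moreover these inequalities are tight: there exist XOR games $J,H$ with $N$ inputs per player such that $\omega_c^{1}(J)\simeq 2^{c/2}\omega(J)$ and $\omega_c^{1}(H)\simeq \dfrac{2^{c/2}}{\sqrt N}$, where $\simeq$ denotes equality up to universal positive multiplicative constants independent of $N$ and $c$.
   Context: A XOR game $G=(f,\pi)$ with $N$ inputs per player consists of $f:[N]\times[N]\to\{-1,1\}$ and a probability distribution $\pi$ on $[N]\times[N]$; we identify it with the matrix $G_{x,y}=\pi(x,y)f(x,y)$. Its classical value is $\omega(G)=\max_{a,b\in\{-1,1\}^N}\sum_{x,y}G_{x,y}a_xb_y$ (equal to the supremum over local strategies with shared randomness). The one-way $c$-bit value $\omega_c^{1}(G)$ is the supremum, over strategies with shared randomness $\lambda$ in which Alice, on input $x$, sends a message $T(x,\lambda)\in\{1,\dots,2^c\}$ to Bob and outputs $\alpha(x,\lambda)\in\{-1,1\}$, and Bob outputs $\beta(y,\lambda,T(x,\lambda))\in\{-1,1\}$, of $\sum_{x,y}G_{x,y}\mathbb E_\lambda[\alpha(x,\lambda)\beta(y,\lambda,T(x,\lambda))]$. $K_G$ denotes the (real) Grothendieck constant, i.e. a universal constant such that for all $N,M$ and every linear operator $u:\ell_\infty^N\to\ell_1^M$ one has $\pi_2(u)\le K_G\|u\|$, where $\pi_2$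 is the 2-summing norm.
   Formalization: Part (b) and the tightness claim are stated only for 2^{c/2} ≤ K_G√N, with K_G the least constant in π_2(u) ≤ K‖u‖; for larger c they fail, since the one-way value is at most 1 (e.g. N=1 and c=2). *)

theory Defs
  imports "HOL-Probability.Probability"
begin

text \<open>
  Inputs are the numbers \<open>1, \<dots>, N\<close>; since \<open>N\<close> varies inside the statements, vectors and matrices
  are functions on \<open>nat\<close> of which only the entries with indices in \<open>{1..N}\<close> are used.
\<close>

definition is_xor_game :: "nat \<Rightarrow> (nat \<Rightarrow> nat \<Rightarrow> real) \<Rightarrow> bool" where
  "is_xor_game N G \<longleftrightarrow>
     (\<exists>(f :: nat \<Rightarrow> nat \<Rightarrow> real) (p :: (nat \<times> nat) pmf).
        (\<forall>x\<in>{1..N}. \<forall>y\<in>{1..N}. f x y \<in> {-1, 1}) \<and>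
        set_pmf p \<subseteq> {1..N} \<times> {1..N} \<and>
        G = (\<lambda>x y. pmf p (x, y) * f x y))"

definition classical_value :: "nat \<Rightarrow> (nat \<Rightarrow> nat \<Rightarrow> real) \<Rightarrow> real" where
  "classical_value N G =
     Max ((\<lambda>(a, b). \<Sum>x\<in>{1..N}. \<Sum>y\<in>{1..N}. G x y * a x * b y) `
            (({1..N} \<rightarrow>\<^sub>E {-1, 1}) \<times> ({1..N} \<rightarrow>\<^sub>E {-1, 1})))"

text \<open>
  \<open>M\<close> is the law of the shared randomness. Measurability into \<open>count_space S\<close> includes
  that the values lie in \<open>S\<close>.
\<close>

definition one_way_strategy ::
  "nat \<Rightarrow> nat \<Rightarrow> 'l measure \<Rightarrow> (nat \<Rightarrow> 'l \<Rightarrow> nat) \<Rightarrow> (nat \<Rightarrow> 'l \<Rightarrow> real) \<Rightarrow>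
   (nat \<Rightarrow> 'l \<Rightarrow> nat \<Rightarrow> real) \<Rightarrow> bool" where
  "one_way_strategy c N M T \<alpha> \<beta> \<longleftrightarrow>
     prob_space M \<and>
     (\<forall>x\<in>{1..N}. T x \<in> M \<rightarrow>\<^sub>M count_space {1..2 ^ c}) \<and>
     (\<forall>x\<in>{1..N}. \<alpha> x \<in> M \<rightarrow>\<^sub>M count_space {-1, 1}) \<and>
     (\<forall>y\<in>{1..N}. \<forall>t\<in>{1..2 ^ c}. (\<lambda>l. \<beta> y l t) \<in> M \<rightarrow>\<^sub>M count_space {-1, 1})"

definition one_way_payoff ::
  "nat \<Rightarrow> (nat \<Rightarrow> nat \<Rightarrow> real) \<Rightarrow> 'l measure \<Rightarrow> (nat \<Rightarrow> 'l \<Rightarrow> nat) \<Rightarrow> (nat \<Rightarrow> 'l \<Rightarrow> real) \<Rightarrow>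
   (nat \<Rightarrow> 'l \<Rightarrow> nat \<Rightarrow> real) \<Rightarrow> real" where
  "one_way_payoff N G M T \<alpha> \<beta> =
     (\<Sum>x\<in>{1..N}. \<Sum>y\<in>{1..N}. G x y * (\<integral>l. \<alpha> x l * \<beta> y l (T x l) \<partial>M))"

text \<open>
  The shared randomness ranges over all probability measures on (any sigma-algebra of) the type
  \<open>real\<close>, which is large enough to carry every standard probability space.
\<close>

definition one_way_value :: "nat \<Rightarrow> nat \<Rightarrow> (nat \<Rightarrow> nat \<Rightarrow> real) \<Rightarrow> real" where
  "one_way_value c N G =
     Sup {one_way_payoff N G M T \<alpha> \<beta> | (M :: real measure) T \<alpha> \<beta>. one_way_strategy c N M T \<alpha> \<beta>}"

text \<open>
  A linear operator from \<open>\<real>\<^sup>N\<close> to \<open>\<real>\<^sup>M\<close> is given by its matrix \<open>u\<close>, and a functional on \<open>\<real>\<^sup>N\<close> by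
  its coefficients. The norm \<open>linf_norm N\<close> is only used for \<open>N \<ge> 1\<close>.
\<close>

definition mat_app :: "nat \<Rightarrow> (nat \<Rightarrow> nat \<Rightarrow> real) \<Rightarrow> (nat \<Rightarrow> real) \<Rightarrow> nat \<Rightarrow> real" where
  "mat_app N u v = (\<lambda>j. \<Sum>i\<in>{1..N}. u j i * v i)"

definition linf_norm :: "nat \<Rightarrow> (nat \<Rightarrow> real) \<Rightarrow> real" where
  "linf_norm N v = Max ((\<lambda>i. \<bar>v i\<bar>) ` {1..N})"

definition l1_norm :: "nat \<Rightarrow> (nat \<Rightarrow> real) \<Rightarrow> real" where
  "l1_norm M w = (\<Sum>j\<in>{1..M}. \<bar>w j\<bar>)"

definition op_norm :: "nat \<Rightarrow> nat \<Rightarrow> (nat \<Rightarrow> nat \<Rightarrow> real) \<Rightarrow> real" where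
  "op_norm N M u = Sup {l1_norm M (mat_app N u v) | v. linf_norm N v \<le> 1}"

definition dual_ball :: "nat \<Rightarrow> (nat \<Rightarrow> real) set" where
  "dual_ball N = {\<phi>. \<forall>v. linf_norm N v \<le> 1 \<longrightarrow> \<bar>\<Sum>i\<in>{1..N}. \<phi> i * v i\<bar> \<le> 1}"

definition weak_two_norm :: "nat \<Rightarrow> nat \<Rightarrow> (nat \<Rightarrow> nat \<Rightarrow> real) \<Rightarrow> real" where
  "weak_two_norm N n v =
     Sup {sqrt (\<Sum>k<n. (\<Sum>i\<in>{1..N}. \<phi> i * v k i)\<^sup>2) | \<phi>. \<phi> \<in> dual_ball N}"

definition two_summing_norm :: "nat \<Rightarrow> nat \<Rightarrow> (nat \<Rightarrow> nat \<Rightarrow> real) \<Rightarrow> real" where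
  "two_summing_norm N M u =
     Inf {C. 0 \<le> C \<and>
           (\<forall>n v. sqrt (\<Sum>k<n. (l1_norm M (mat_app N u (v k)))\<^sup>2) \<le> C * weak_two_norm N n v)}"

definition grothendieck_bound :: "real \<Rightarrow> bool" where
  "grothendieck_bound K \<longleftrightarrow>
     (\<forall>N M u. 1 \<le> N \<longrightarrow> 1 \<le> M \<longrightarrow> two_summing_norm N M u \<le> K * op_norm N M u)"

text \<open>
  \<open>K\<^sub>G\<close> is taken to be the least constant in \<open>\<pi>\<^sub>2(u) \<le> K \<parallel>u\<parallel>\<close>. It does not exceed the least
  constant in the inner-product form of Grothendieck's inequality, which also satisfies
  \<open>grothendieck_bound\<close>; an upper bound increasing in \<open>K\<close>, or a lower bound decreasing in \<open>K\<close>, is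
  therefore strongest for this choice. That the set is nonempty is Grothendieck's theorem.
\<close>

definition KG :: real where
  "KG = Inf {K. grothendieck_bound K}"

text \<open>
  Since \<open>one_way_value c N G \<le> 1\<close> for every game, a lower bound \<open>2\<^bsup>c/2\<^esup> / (K\<^sub>G \<surd>N)\<close> can hold only
  if that number is at most 1, i.e. \<open>2\<^sup>c \<le> K\<^sub>G\<^sup>2 N\<close>. Beyond that the message can carry Alice's whole
  input and the value is 1. All \<open>c\<close> with \<open>2\<^sup>c \<le> N\<close> are covered, as \<open>K\<^sub>G \<ge> 1\<close>.
\<close>

definition nontrivial_regime :: "nat \<Rightarrow> nat \<Rightarrow> bool" where
  "nontrivial_regime c N \<longleftrightarrow> 2 powr (real c / 2) / (KG * sqrt (real N)) \<le> 1"

end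

theory Submission
  imports Defs
begin

text \<open>
  Upper bound: the message of a deterministic strategy splits Alice's output into \<open>2\<^sup>c\<close> disjointly
  supported vectors, jointly of weak 2-norm at most 1, and the payoff is at most the sum of the
  \<open>\<ell>\<^sub>1\<close>-norms of their images under the game matrix. Cauchy--Schwarz costs \<open>2\<^bsup>c/2\<^esup>\<close> and the
  2-summing norm costs \<open>K\<^sub>G\<close>. That \<open>K\<^sub>G\<close> is finite is shown by truncating Rademacher sums: if \<open>\<Lambda>\<close> is the
  Hilbertian value of a matrix of norm \<open>B\<close>, cutting the sums off at 1 gives
  \<open>\<Lambda> \<le> B + (\<surd>3/2) \<Lambda>\<close>.

  Lower bound: with blocks of sizes \<open>n\<^sub>t\<close>, random signs and majority votes give the value
  \<open>(1/N) \<Sum>\<^sub>t R(n\<^sub>t)\<close>, where \<open>R(n)\<close> is the mean absolute value of a sum of \<open>n\<close> random signs. For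
  balanced blocks this is at least \<open>2\<^bsup>c/2\<^esup> / \<surd>(2N)\<close>, also when \<open>2\<^sup>c\<close> does not divide \<open>N\<close>, which
  suffices because the CHSH matrix shows \<open>K\<^sub>G \<ge> \<surd>2\<close>. Both bounds are attained, up to constants, by
  Walsh matrices of the largest admissible size.
\<close>

subsection \<open>Sign averages\<close>

text \<open>Sign vectors are encoded as subsets, so a sum over \<open>Pow S\<close> is
  \<open>2 ^ card S\<close> times an expectation over independent uniform signs.\<close>

definition sgnf :: "'a set \<Rightarrow> 'a \<Rightarrow> real" where
  "sgnf A k = (if k \<in> A then 1 else -1)"

lemma sum_Pow_insert:
  fixes h :: "'a set \<Rightarrow> real"
  assumes "finite S" "a \<notin> S"
  shows "(\<Sum>A\<in>Pow (insert a S). h A) = (\<Sum>A\<in>Pow S. h A + h (insert a A))"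
proof -
  have "inj_on (insert a) (Pow S)"
    using assms by (auto simp: inj_on_def)
  moreover have "Pow S \<inter> insert a ` Pow S = {}" using assms by auto
  ultimately show ?thesis
    using assms by (simp add: Pow_insert sum.union_disjoint sum.reindex sum.distrib)
qed

text \<open>Splits off the sign at \<open>a\<close>. Carrying two linear forms in the same signs
  lets one identity drive the inner-product, fourth-moment and sign-change inductions.\<close>

lemma sum_Pow_insert_sgnf:
  fixes h :: "real \<Rightarrow> real \<Rightarrow> real"
  assumes "finite S" "a \<notin> S"
  shows "(\<Sum>A\<in>Pow (insert a S). h (\<Sum>k\<in>insert a S. x k * sgnf A k) (\<Sum>k\<in>insert a S. y k * sgnf A k))
       = (\<Sum>A\<in>Pow S. h ((\<Sum>k\<in>S. x k * sgnf A k) - x a) ((\<Sum>k\<in>S. y k * sgnf A k) - y a)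
                   + h ((\<Sum>k\<in>S. x k * sgnf A k) + x a) ((\<Sum>k\<in>S. y k * sgnf A k) + y a))"
proof -
  have e: "(\<Sum>k\<in>S. w k * sgnf (insert a A) k) = (\<Sum>k\<in>S. w k * sgnf A k)" for w A
    using assms by (intro sum.cong) (auto simp: sgnf_def)
  show ?thesis
    unfolding sum_Pow_insert[OF assms]
    using assms by (intro sum.cong refl) (auto simp: e sgnf_def[of _ a] add.commute)
qed

text \<open>Independent signs are orthonormal, so passing to Rademacher sums embeds Euclidean space
  isometrically into L2, up to the total mass \<open>2 ^ card S\<close>.\<close>

lemma sgnf_inner:
  assumes "finite S"
  shows "(\<Sum>A\<in>Pow S. (\<Sum>k\<in>S. x k * sgnf A k) * (\<Sum>k\<in>S. y k * sgnf A k))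
       = 2 ^ card S * (\<Sum>k\<in>S. x k * y k)"
  using assms
proof (induction S rule: finite_induct)
  case (insert a S)
  have "(\<Sum>A\<in>Pow (insert a S). (\<Sum>k\<in>insert a S. x k * sgnf A k) * (\<Sum>k\<in>insert a S. y k * sgnf A k))
      = (\<Sum>A\<in>Pow S. 2 * ((\<Sum>k\<in>S. x k * sgnf A k) * (\<Sum>k\<in>S. y k * sgnf A k)) + 2 * (x a * y a))"
    unfolding sum_Pow_insert_sgnf[OF insert.hyps, of "(*)" x y] by (simp add: algebra_simps)
  also have "\<dots> = 2 ^ card (insert a S) * (\<Sum>k\<in>insert a S. x k * y k)"
    using insert by (simp add: sum.distrib sum_distrib_left[symmetric] card_Pow algebra_simps)
  finally show ?case .
qed simp

text \<open>A Khintchine-type comparison of the fourth moment with the squared second moment, with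
  the Gaussian constant 3. It makes the tails of Rademacher sums small in L2.\<close>

lemma sgnf_fourth:
  assumes "finite S"
  shows "(\<Sum>A\<in>Pow S. (\<Sum>k\<in>S. x k * sgnf A k) ^ 4) \<le> 3 * 2 ^ card S * (\<Sum>k\<in>S. (x k)\<^sup>2)\<^sup>2"
  using assms
proof (induction S rule: finite_induct)
  case (insert a S)
  let ?X = "\<lambda>A. \<Sum>k\<in>S. x k * sgnf A k" and ?q = "\<Sum>k\<in>S. (x k)\<^sup>2"
  have 2: "(\<Sum>A\<in>Pow S. (?X A)\<^sup>2) = 2 ^ card S * ?q"
    using sgnf_inner[OF insert.hyps(1), of x x] by (simp add: power2_eq_square)
  have "(\<Sum>A\<in>Pow (insert a S). (\<Sum>k\<in>insert a S. x k * sgnf A k) ^ 4)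
      = (\<Sum>A\<in>Pow S. 2 * ?X A ^ 4 + 12 * (x a)\<^sup>2 * (?X A)\<^sup>2 + 2 * x a ^ 4)"
    unfolding sum_Pow_insert_sgnf[OF insert.hyps, of "\<lambda>s _. s ^ 4" x x]
    by (intro sum.cong refl) (simp add: power4_eq_xxxx power2_eq_square algebra_simps)
  also have "\<dots> = 2 * (\<Sum>A\<in>Pow S. ?X A ^ 4) + 12 * (x a)\<^sup>2 * (2 ^ card S * ?q) + 2 ^ card S * (2 * x a ^ 4)"
    using insert.hyps by (simp add: sum.distrib sum_distrib_left[symmetric] card_Pow 2)
  \<comment> \<open>Raising \<open>2 * x a ^ 4\<close> to \<open>6 * x a ^ 4\<close> completes the
    square of \<open>?q\<close> plus the new squared coefficient.\<close>
  also have "\<dots> \<le> 2 * (3 * 2 ^ card S * ?q\<^sup>2) + 12 * (x a)\<^sup>2 * (2 ^ card S * ?q) + 2 ^ card S * (6 * x a ^ 4)"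
    using insert.IH by (intro add_mono mult_left_mono) auto
  also have "\<dots> = 3 * 2 ^ card (insert a S) * (\<Sum>k\<in>insert a S. (x k)\<^sup>2)\<^sup>2"
    using insert.hyps by (simp add: power4_eq_xxxx power2_eq_square algebra_simps)
  finally show ?case .
qed simp

subsection \<open>Grothendieck's inequality\<close>

text \<open>Beyond the cut-off the error is |t| - 1, at most t^2/4 because (|t| - 2)^2 is
  nonnegative. The resulting fourth power is what the moment bound controls.\<close>

lemma clip_error_sq_le:
  fixes t :: real
  shows "(t - max (-1) (min 1 t))\<^sup>2 \<le> t ^ 4 / 16"
proof -
  have "\<bar>t - max (-1) (min 1 t)\<bar> \<le> t\<^sup>2 / 4"
  proof -
    have "0 \<le> (t - 2)\<^sup>2" "0 \<le> (t + 2)\<^sup>2" by auto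
    then show ?thesis by (auto simp: power2_eq_square algebra_simps max_def min_def abs_if)
  qed
  then have "\<bar>t - max (-1) (min 1 t)\<bar>\<^sup>2 \<le> (t\<^sup>2 / 4)\<^sup>2" by (intro power_mono) auto
  then show ?thesis by (simp add: power_divide flip: power_mult)
qed

text \<open>The supremum of the Hilbertian values is at most \<open>B\<close> plus a fraction below
  1 of itself, and being finite it can be absorbed. The constant comes from 1 / (1 - sqrt 3 / 2) <
  8.\<close>

lemma grothendieck_inequality:
  fixes u :: "'i \<Rightarrow> 'j \<Rightarrow> real"
  assumes B: "\<And>a b. (\<And>i. i \<in> I \<Longrightarrow> \<bar>a i\<bar> \<le> 1) \<Longrightarrow> (\<And>j. j \<in> J \<Longrightarrow> \<bar>b j\<bar> \<le> 1) \<Longrightarrow>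
      (\<Sum>i\<in>I. \<Sum>j\<in>J. u i j * (a i * b j)) \<le> B"
  assumes x: "\<And>i. i \<in> I \<Longrightarrow> (\<Sum>k<n. (x i k)\<^sup>2) \<le> 1"
    and y: "\<And>j. j \<in> J \<Longrightarrow> (\<Sum>k<n. (y j k)\<^sup>2) \<le> 1"
  shows "(\<Sum>i\<in>I. \<Sum>j\<in>J. u i j * (\<Sum>k<(n::nat). x i k * y j k)) \<le> 8 * B"
proof -
  \<comment> \<open>The dimension \<open>n\<close> varies inside \<open>V\<close> because the
    truncated sums are vectors indexed by sign patterns, so they live in dimension
    \<open>2 ^ n\<close>.\<close>
  define V where "V = {(\<Sum>i\<in>I. \<Sum>j\<in>J. u i j * (\<Sum>k<(n::nat). x i k * y j k)) | n x y.
      (\<forall>i\<in>I. (\<Sum>k<n. (x i k)\<^sup>2) \<le> 1) \<and> (\<forall>j\<in>J. (\<Sum>k<n. (y j k)\<^sup>2) \<le> 1)}"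
  have cs: "\<bar>\<Sum>k<n. p k * q k\<bar> \<le> 1" if "(\<Sum>k<n. (p k)\<^sup>2) \<le> 1" "(\<Sum>k<n. (q k)\<^sup>2) \<le> 1"
    for n :: nat and p q :: "nat \<Rightarrow> real"
  proof -
    have "\<bar>\<Sum>k<n. p k * q k\<bar>\<^sup>2 \<le> (\<Sum>k<n. (p k)\<^sup>2) * (\<Sum>k<n. (q k)\<^sup>2)"
      using Cauchy_Schwarz_ineq_sum[of p q "{..<n}"] by simp
    also have "\<dots> \<le> 1" using that by (intro mult_le_one) (auto intro: sum_nonneg)
    finally show ?thesis by (simp add: abs_le_square_iff[symmetric] abs_square_le_1)
  qed
  have bdd: "bdd_above V"
  proof (rule bdd_aboveI)
    fix v assume "v \<in> V"
    then obtain n x y where v: "v = (\<Sum>i\<in>I. \<Sum>j\<in>J. u i j * (\<Sum>k<(n::nat). x i k * y j k))"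
      and "\<forall>i\<in>I. (\<Sum>k<n. (x i k)\<^sup>2) \<le> 1" "\<forall>j\<in>J. (\<Sum>k<n. (y j k)\<^sup>2) \<le> 1"
      unfolding V_def by blast
    then have "u i j * (\<Sum>k<n. x i k * y j k) \<le> \<bar>u i j\<bar>" if "i \<in> I" "j \<in> J" for i j
    proof -
      have "\<bar>u i j * (\<Sum>k<n. x i k * y j k)\<bar> \<le> \<bar>u i j\<bar> * 1"
        unfolding abs_mult using cs[of "x i" n "y j"] that
          \<open>\<forall>i\<in>I. (\<Sum>k<n. (x i k)\<^sup>2) \<le> 1\<close> \<open>\<forall>j\<in>J. (\<Sum>k<n. (y j k)\<^sup>2) \<le> 1\<close>
        by (intro mult_left_mono) auto
      then show ?thesis by linarith
    qed
    then show "v \<le> (\<Sum>i\<in>I. \<Sum>j\<in>J. \<bar>u i j\<bar>)"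
      unfolding v by (intro sum_mono) auto
  qed
  \<comment> \<open>Homogeneity: vectors of norms at most \<open>s\<close> and \<open>t\<close>,
    indexed by a finite set of sign patterns, are renumbered and rescaled into
    \<open>V\<close>.\<close>
  have up: "(\<Sum>i\<in>I. \<Sum>j\<in>J. u i j * (\<Sum>k\<in>S. x i k * y j k)) \<le> Sup V * (s * t)"
    if "finite S" and s: "0 < s" and t: "0 < t"
      and x: "\<And>i. i \<in> I \<Longrightarrow> (\<Sum>k\<in>S. (x i k)\<^sup>2) \<le> s\<^sup>2"
      and y: "\<And>j. j \<in> J \<Longrightarrow> (\<Sum>k\<in>S. (y j k)\<^sup>2) \<le> t\<^sup>2"
    for S :: "nat set set" and x :: "'i \<Rightarrow> nat set \<Rightarrow> real" and y :: "'j \<Rightarrow> nat set \<Rightarrow> real" and s t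
  proof -
    obtain g where g: "bij_betw g {..<card S} S"
      using ex_bij_betw_nat_finite[OF \<open>finite S\<close>] by (auto simp: atLeast0LessThan)
    have re: "(\<Sum>k<card S. h (g k)) = (\<Sum>k\<in>S. h k)" for h :: "nat set \<Rightarrow> real"
      by (rule sum.reindex_bij_betw[OF g])
    have 1: "(\<Sum>k<card S. (x i (g k) / s)\<^sup>2) \<le> 1" if "i \<in> I" for i
      using x[OF that] s re[of "\<lambda>k. (x i k)\<^sup>2"]
      by (simp add: power_divide sum_divide_distrib[symmetric] divide_le_eq)
    have 2: "(\<Sum>k<card S. (y i (g k) / t)\<^sup>2) \<le> 1" if "i \<in> J" for i
      using y[OF that] t re[of "\<lambda>k. (y i k)\<^sup>2"]
      by (simp add: power_divide sum_divide_distrib[symmetric] divide_le_eq)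
    have "(\<Sum>i\<in>I. \<Sum>j\<in>J. u i j * (\<Sum>k<card S. (x i (g k) / s) * (y j (g k) / t))) \<in> V"
      unfolding V_def using 1 2
      by (intro CollectI exI[of _ "card S"] exI[of _ "\<lambda>i k. x i (g k) / s"]
          exI[of _ "\<lambda>j k. y j (g k) / t"]) auto
    then have "(\<Sum>i\<in>I. \<Sum>j\<in>J. u i j * (\<Sum>k<card S. (x i (g k) / s) * (y j (g k) / t))) \<le> Sup V"
      by (intro cSup_upper bdd)
    also have "(\<Sum>i\<in>I. \<Sum>j\<in>J. u i j * (\<Sum>k<card S. (x i (g k) / s) * (y j (g k) / t)))
        = (\<Sum>i\<in>I. \<Sum>j\<in>J. u i j * (\<Sum>k\<in>S. x i k * y j k)) / (s * t)"
      using re[of "\<lambda>k. x i k * y j k" for i j]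
      by (simp add: sum_divide_distrib[symmetric])
    finally show ?thesis using s t by (simp add: divide_le_eq)
  qed
  have step: "v \<le> B + sqrt 3 / 2 * Sup V" if vV: "v \<in> V" for v
  proof -
    obtain n x y where v: "v = (\<Sum>i\<in>I. \<Sum>j\<in>J. u i j * (\<Sum>k<(n::nat). x i k * y j k))"
      and x: "\<And>i. i \<in> I \<Longrightarrow> (\<Sum>k<n. (x i k)\<^sup>2) \<le> 1" and y: "\<And>j. j \<in> J \<Longrightarrow> (\<Sum>k<n. (y j k)\<^sup>2) \<le> 1"
      using vV unfolding V_def by blast
    define D :: real where "D = 2 ^ n"
    have D: "0 < D" by (simp add: D_def)
    define clip :: "real \<Rightarrow> real" where "clip t = max (-1) (min 1 t)" for t
    have clip1: "\<bar>clip t\<bar> \<le> 1" "(clip t)\<^sup>2 \<le> t\<^sup>2" for t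
    proof -
      show "\<bar>clip t\<bar> \<le> 1" by (auto simp: clip_def)
      have "\<bar>clip t\<bar> \<le> \<bar>t\<bar>" by (auto simp: clip_def max_def min_def)
      then show "(clip t)\<^sup>2 \<le> t\<^sup>2" by (simp add: abs_le_square_iff)
    qed
    let ?S = "Pow {..<n}"
    define X where "X i A = (\<Sum>k<n. x i k * sgnf A k)" for i A
    define Y where "Y j A = (\<Sum>k<n. y j k * sgnf A k)" for j A
    have XY: "(\<Sum>A\<in>?S. X i A * Y j A) = D * (\<Sum>k<n. x i k * y j k)" for i j
      using sgnf_inner[of "{..<n}" "x i" "y j"] by (simp add: X_def Y_def D_def)
    \<comment> \<open>Norms are taken for counting measure on \<open>2 ^ n\<close> patterns:
      \<open>sqrt D\<close> for a full sum, and \<open>sqrt 3 / 4 * sqrt D\<close> for its tail,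
      since the fourth moment is at most \<open>3 * D\<close> and the clip error costs a factor
      1/16.\<close>
    have sq: "(\<Sum>A\<in>Pow {..<n}. (\<Sum>k<n. z k * sgnf A k)\<^sup>2) \<le> (sqrt D)\<^sup>2"
      and tail: "(\<Sum>A\<in>Pow {..<n}. ((\<Sum>k<n. z k * sgnf A k) - clip (\<Sum>k<n. z k * sgnf A k))\<^sup>2)
         \<le> (sqrt 3 / 4 * sqrt D)\<^sup>2"
      if z: "(\<Sum>k<n. (z k)\<^sup>2) \<le> 1" for z :: "nat \<Rightarrow> real"
    proof -
      show "(\<Sum>A\<in>Pow {..<n}. (\<Sum>k<n. z k * sgnf A k)\<^sup>2) \<le> (sqrt D)\<^sup>2"
        using sgnf_inner[of "{..<n}" z z] z D by (simp add: power2_eq_square D_def)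
      have "(\<Sum>A\<in>Pow {..<n}. ((\<Sum>k<n. z k * sgnf A k) - clip (\<Sum>k<n. z k * sgnf A k))\<^sup>2)
         \<le> (\<Sum>A\<in>Pow {..<n}. (\<Sum>k<n. z k * sgnf A k) ^ 4 / 16)"
        unfolding clip_def by (intro sum_mono clip_error_sq_le)
      also have "\<dots> = (\<Sum>A\<in>Pow {..<n}. (\<Sum>k<n. z k * sgnf A k) ^ 4) / 16"
        by (simp add: sum_divide_distrib)
      also have "\<dots> \<le> (3 * D * (\<Sum>k<n. (z k)\<^sup>2)\<^sup>2) / 16"
        using sgnf_fourth[of "{..<n}" z] by (simp add: D_def)
      also have "\<dots> \<le> 3 * D * 1 / 16"
        using z D by (intro divide_right_mono mult_left_mono power_le_one) (auto intro: sum_nonneg)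
      also have "\<dots> = (sqrt 3 / 4 * sqrt D)\<^sup>2"
        using D by (simp add: power_mult_distrib power_divide)
      finally show "(\<Sum>A\<in>Pow {..<n}. ((\<Sum>k<n. z k * sgnf A k) - clip (\<Sum>k<n. z k * sgnf A k))\<^sup>2)
         \<le> (sqrt 3 / 4 * sqrt D)\<^sup>2" .
    qed
    \<comment> \<open>The first term has factors bounded by 1, so \<open>B\<close> applies for each
      sign pattern. Each of the other two contains one tail and costs \<open>sqrt 3 / 4\<close>
      times \<open>Sup V\<close>.\<close>
    have split: "D * (\<Sum>k<n. x i k * y j k) =
        (\<Sum>A\<in>?S. clip (X i A) * clip (Y j A)) + (\<Sum>A\<in>?S. (X i A - clip (X i A)) * clip (Y j A))
          + (\<Sum>A\<in>?S. X i A * (Y j A - clip (Y j A)))" for i j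
      unfolding XY[symmetric] sum.distrib[symmetric] by (intro sum.cong) (auto simp: algebra_simps)
    have "D * v = (\<Sum>i\<in>I. \<Sum>j\<in>J. u i j * (D * (\<Sum>k<n. x i k * y j k)))"
      unfolding v by (simp add: sum_distrib_left algebra_simps)
    also have "\<dots> = (\<Sum>i\<in>I. \<Sum>j\<in>J. u i j * (\<Sum>A\<in>?S. clip (X i A) * clip (Y j A)))
        + (\<Sum>i\<in>I. \<Sum>j\<in>J. u i j * (\<Sum>A\<in>?S. (X i A - clip (X i A)) * clip (Y j A)))
        + (\<Sum>i\<in>I. \<Sum>j\<in>J. u i j * (\<Sum>A\<in>?S. X i A * (Y j A - clip (Y j A))))"
      unfolding split by (simp add: distrib_left sum.distrib)
    also have "\<dots> \<le> D * B + Sup V * (sqrt 3 / 4 * sqrt D * sqrt D) + Sup V * (sqrt D * (sqrt 3 / 4 * sqrt D))"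
    proof (intro add_mono)
      have "(\<Sum>i\<in>I. \<Sum>j\<in>J. u i j * (\<Sum>A\<in>?S. clip (X i A) * clip (Y j A)))
          = (\<Sum>i\<in>I. \<Sum>A\<in>?S. \<Sum>j\<in>J. u i j * (clip (X i A) * clip (Y j A)))"
        by (simp add: sum_distrib_left) (intro sum.cong refl sum.swap)
      also have "\<dots> = (\<Sum>A\<in>?S. \<Sum>i\<in>I. \<Sum>j\<in>J. u i j * (clip (X i A) * clip (Y j A)))"
        by (rule sum.swap)
      also have "\<dots> \<le> (\<Sum>A\<in>?S. B)" by (intro sum_mono B clip1)
      also have "\<dots> = D * B" by (simp add: card_Pow D_def)
      finally show "(\<Sum>i\<in>I. \<Sum>j\<in>J. u i j * (\<Sum>A\<in>?S. clip (X i A) * clip (Y j A))) \<le> D * B" .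
      have clipsq: "(\<Sum>A\<in>?S. (clip (Y j A))\<^sup>2) \<le> (sqrt D)\<^sup>2" if "j \<in> J" for j
        using sum_mono[of ?S "\<lambda>A. (clip (Y j A))\<^sup>2" "\<lambda>A. (Y j A)\<^sup>2"] clip1 sq[OF y[OF that]]
        by (fastforce simp: Y_def)
      show "(\<Sum>i\<in>I. \<Sum>j\<in>J. u i j * (\<Sum>A\<in>?S. (X i A - clip (X i A)) * clip (Y j A)))
          \<le> Sup V * (sqrt 3 / 4 * sqrt D * sqrt D)"
        using tail[OF x] clipsq D by (intro up) (auto simp: X_def)
      show "(\<Sum>i\<in>I. \<Sum>j\<in>J. u i j * (\<Sum>A\<in>?S. X i A * (Y j A - clip (Y j A))))
          \<le> Sup V * (sqrt D * (sqrt 3 / 4 * sqrt D))"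
        using tail[OF y] sq[OF x] D by (intro up) (auto simp: X_def Y_def)
    qed
    also have "\<dots> = D * (B + sqrt 3 / 2 * Sup V)"
      using D by (simp add: algebra_simps)
    finally show ?thesis using D by simp
  qed
  have "(\<Sum>i\<in>I. \<Sum>j\<in>J. u i j * (\<Sum>k<n. x i k * y j k)) \<in> V"
    unfolding V_def using x y by blast
  then have le: "(\<Sum>i\<in>I. \<Sum>j\<in>J. u i j * (\<Sum>k<n. x i k * y j k)) \<le> Sup V" and "V \<noteq> {}"
    by (auto intro: cSup_upper bdd)
  then have *: "Sup V \<le> B + sqrt 3 / 2 * Sup V" by (intro cSup_least step)
  have "0 \<le> B" using B[of "\<lambda>_. 0" "\<lambda>_. 0"] by simp
  \<comment> \<open>The rational bound 7/4 turns \<open>sqrt 3 / 2\<close> into 7/8, leaving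
    \<open>Sup V / 8\<close> on the left.\<close>
  have "(sqrt 3)\<^sup>2 \<le> (7 / 4)\<^sup>2" by (simp add: power2_eq_square)
  then have "sqrt 3 \<le> 7 / 4" by (rule power2_le_imp_le) simp
  have "Sup V \<le> 8 * B"
  proof (cases "0 \<le> Sup V")
    case True
    then have "sqrt 3 / 2 * Sup V \<le> 7 / 8 * Sup V"
      using \<open>sqrt 3 \<le> 7 / 4\<close> by (intro mult_right_mono) auto
    then show ?thesis using * by linarith
  qed (use \<open>0 \<le> B\<close> in linarith)
  with le show ?thesis by linarith
qed

subsection \<open>The 2-summing norm and its constant\<close>

lemma linf_norm_le_iff:
  "1 \<le> N \<Longrightarrow> linf_norm N v \<le> c \<longleftrightarrow> (\<forall>i\<in>{1..N}. \<bar>v i\<bar> \<le> c)"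
  unfolding linf_norm_def by (subst Max_le_iff) auto

lemma dual_ball_sum_abs_le:
  assumes "1 \<le> N" "\<phi> \<in> dual_ball N"
  shows "(\<Sum>i\<in>{1..N}. \<bar>\<phi> i\<bar>) \<le> 1"
proof -
  have "linf_norm N (\<lambda>i. sgn (\<phi> i)) \<le> 1"
    using assms(1) by (simp add: linf_norm_le_iff abs_sgn_eq)
  then have "\<bar>\<Sum>i\<in>{1..N}. \<phi> i * sgn (\<phi> i)\<bar> \<le> 1" using assms(2) by (auto simp: dual_ball_def)
  then show ?thesis by (simp flip: abs_sgn)
qed

text \<open>Cauchy-Schwarz with the weights \<open>\<bar>\<phi> i\<bar>\<close>, whose total is at
  most 1. Thus no functional of the dual ball does better than the best coordinate
  functional.\<close>

lemma dual_ball_two_norm_le: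
  assumes "1 \<le> N" "\<phi> \<in> dual_ball N" "0 \<le> W"
    and v: "\<And>i. i \<in> {1..N} \<Longrightarrow> (\<Sum>k<n. (v k i)\<^sup>2) \<le> W\<^sup>2"
  shows "sqrt (\<Sum>k<n. (\<Sum>i\<in>{1..N}. \<phi> i * v k i)\<^sup>2) \<le> W"
proof -
  let ?s = "\<Sum>i\<in>{1..N}. \<bar>\<phi> i\<bar>"
  have s: "?s \<le> 1" by (rule dual_ball_sum_abs_le[OF assms(1,2)])
  have "(\<Sum>i\<in>{1..N}. \<phi> i * v k i)\<^sup>2 \<le> (\<Sum>i\<in>{1..N}. \<bar>\<phi> i\<bar> * (v k i)\<^sup>2)" for k
  proof -
    have "(\<Sum>i\<in>{1..N}. \<phi> i * v k i)
        = (\<Sum>i\<in>{1..N}. (sgn (\<phi> i) * sqrt \<bar>\<phi> i\<bar>) * (sqrt \<bar>\<phi> i\<bar> * v k i))"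
    proof (intro sum.cong refl)
      fix i
      have "\<phi> i = sgn (\<phi> i) * (sqrt \<bar>\<phi> i\<bar> * sqrt \<bar>\<phi> i\<bar>)" by (simp add: sgn_mult_abs)
      then show "\<phi> i * v k i = (sgn (\<phi> i) * sqrt \<bar>\<phi> i\<bar>) * (sqrt \<bar>\<phi> i\<bar> * v k i)"
        by (metis mult.assoc)
    qed
    also have "\<dots>\<^sup>2 \<le> (\<Sum>i\<in>{1..N}. (sgn (\<phi> i) * sqrt \<bar>\<phi> i\<bar>)\<^sup>2)
        * (\<Sum>i\<in>{1..N}. (sqrt \<bar>\<phi> i\<bar> * v k i)\<^sup>2)"
      by (rule Cauchy_Schwarz_ineq_sum)
    also have "\<dots> = ?s * (\<Sum>i\<in>{1..N}. \<bar>\<phi> i\<bar> * (v k i)\<^sup>2)"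
    proof -
      have "(sgn (\<phi> i) * sqrt \<bar>\<phi> i\<bar>)\<^sup>2 = \<bar>\<phi> i\<bar>" for i
        by (simp add: power_mult_distrib sgn_if)
      moreover have "(sqrt \<bar>\<phi> i\<bar> * v k i)\<^sup>2 = \<bar>\<phi> i\<bar> * (v k i)\<^sup>2" for i
        by (simp add: power_mult_distrib)
      ultimately show ?thesis by (simp only:)
    qed
    also have "\<dots> \<le> 1 * (\<Sum>i\<in>{1..N}. \<bar>\<phi> i\<bar> * (v k i)\<^sup>2)"
      by (intro mult_right_mono s sum_nonneg) auto
    finally show ?thesis by simp
  qed
  then have "(\<Sum>k<n. (\<Sum>i\<in>{1..N}. \<phi> i * v k i)\<^sup>2) \<le> (\<Sum>k<n. \<Sum>i\<in>{1..N}. \<bar>\<phi> i\<bar> * (v k i)\<^sup>2)"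
    by (intro sum_mono)
  also have "\<dots> = (\<Sum>i\<in>{1..N}. \<bar>\<phi> i\<bar> * (\<Sum>k<n. (v k i)\<^sup>2))"
    by (subst sum.swap) (simp add: sum_distrib_left)
  also have "\<dots> \<le> (\<Sum>i\<in>{1..N}. \<bar>\<phi> i\<bar> * W\<^sup>2)"
    by (intro sum_mono mult_left_mono v) auto
  also have "\<dots> = ?s * W\<^sup>2" by (simp add: sum_distrib_right)
  also have "\<dots> \<le> 1 * W\<^sup>2" by (intro mult_right_mono s) auto
  finally show ?thesis using \<open>0 \<le> W\<close> by (simp add: real_le_lsqrt)
qed

lemma weak_two_norm_le:
  assumes "1 \<le> N" "0 \<le> W" "\<And>i. i \<in> {1..N} \<Longrightarrow> (\<Sum>k<n. (v k i)\<^sup>2) \<le> W\<^sup>2"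
  shows "weak_two_norm N n v \<le> W"
  unfolding weak_two_norm_def
proof (rule cSup_least)
  have "(\<lambda>_. 0) \<in> dual_ball N" by (simp add: dual_ball_def)
  then show "{sqrt (\<Sum>k<n. (\<Sum>i\<in>{1..N}. \<phi> i * v k i)\<^sup>2) | \<phi>. \<phi> \<in> dual_ball N} \<noteq> {}" by blast
qed (use dual_ball_two_norm_le[OF assms(1) _ assms(2,3)] in auto)

text \<open>Tested at the coordinate functional of \<open>i\<close>. Together with
  \<open>weak_two_norm_le\<close> this makes the weak 2-norm the largest Euclidean norm of a
  coordinate sequence.\<close>

lemma weak_two_norm_ge:
  assumes "i \<in> {1..N}"
  shows "sqrt (\<Sum>k<n. (v k i)\<^sup>2) \<le> weak_two_norm N n v"
  unfolding weak_two_norm_def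
proof (rule cSup_upper)
  have N: "1 \<le> N" using assms by auto
  define \<phi> :: "nat \<Rightarrow> real" where "\<phi> j = (if j = i then 1 else 0)" for j
  have s: "(\<Sum>j\<in>{1..N}. \<phi> j * w j) = w i" for w
    using assms by (simp add: \<phi>_def if_distrib[of "\<lambda>t. t * _"] cong: if_cong)
  have "\<phi> \<in> dual_ball N"
    unfolding dual_ball_def linf_norm_le_iff[OF N] mem_Collect_eq s using assms by blast
  then show "sqrt (\<Sum>k<n. (v k i)\<^sup>2)
      \<in> {sqrt (\<Sum>k<n. (\<Sum>i\<in>{1..N}. \<phi> i * v k i)\<^sup>2) | \<phi>. \<phi> \<in> dual_ball N}"
    unfolding mem_Collect_eq by (intro exI[of _ \<phi>]) (simp only: s simp_thms)
  \<comment> \<open>A crude bound, there only to show that the supremum is taken over a bounded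
    set.\<close>
  define W where "W = sqrt (\<Sum>i\<in>{1..N}. \<Sum>k<n. (v k i)\<^sup>2)"
  have W: "(\<Sum>k<n. (v k i)\<^sup>2) \<le> W\<^sup>2" if "i \<in> {1..N}" for i
    using member_le_sum[of i "{1..N}" "\<lambda>i. \<Sum>k<n. (v k i)\<^sup>2"] that
    by (auto simp: W_def sum_nonneg)
  have "0 \<le> W" by (simp add: W_def sum_nonneg)
  show "bdd_above {sqrt (\<Sum>k<n. (\<Sum>i\<in>{1..N}. \<phi> i * v k i)\<^sup>2) | \<phi>. \<phi> \<in> dual_ball N}"
    by (rule bdd_aboveI[of _ W]) (use dual_ball_two_norm_le[OF N _ \<open>0 \<le> W\<close> W] in auto)
qed

lemma weak_two_norm_nonneg: "1 \<le> N \<Longrightarrow> 0 \<le> weak_two_norm N n v"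
  by (rule order_trans[OF _ weak_two_norm_ge[of 1]]) (simp_all add: sum_nonneg)

section \<open>The operator norm and 2-summing estimates\<close>

lemma bdd_above_op_norm:
  assumes "1 \<le> N"
  shows "bdd_above {l1_norm M (mat_app N u v) | v. linf_norm N v \<le> 1}"
proof (rule bdd_aboveI[of _ "\<Sum>j\<in>{1..M}. \<Sum>i\<in>{1..N}. \<bar>u j i\<bar>"], clarify)
  fix v assume "linf_norm N v \<le> 1"
  then have v: "\<bar>v i\<bar> \<le> 1" if "i \<in> {1..N}" for i using assms that by (simp add: linf_norm_le_iff)
  have "\<bar>\<Sum>i\<in>{1..N}. u j i * v i\<bar> \<le> (\<Sum>i\<in>{1..N}. \<bar>u j i\<bar>)" for j
    using v by (intro order_trans[OF sum_abs] sum_mono) (auto simp: abs_mult intro: mult_left_le)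
  then show "l1_norm M (mat_app N u v) \<le> (\<Sum>j\<in>{1..M}. \<Sum>i\<in>{1..N}. \<bar>u j i\<bar>)"
    unfolding l1_norm_def mat_app_def by (intro sum_mono)
qed

lemma op_norm_ge:
  assumes "1 \<le> N" "\<And>i. i \<in> {1..N} \<Longrightarrow> \<bar>v i\<bar> \<le> 1"
  shows "l1_norm M (mat_app N u v) \<le> op_norm N M u"
  unfolding op_norm_def
  by (rule cSup_upper[OF _ bdd_above_op_norm]) (use assms in \<open>auto simp: linf_norm_le_iff\<close>)

lemma op_norm_le:
  assumes "1 \<le> N" "\<And>v. (\<And>i. i \<in> {1..N} \<Longrightarrow> \<bar>v i\<bar> \<le> 1) \<Longrightarrow> l1_norm M (mat_app N u v) \<le> B"
  shows "op_norm N M u \<le> B"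
  unfolding op_norm_def
proof (rule cSup_least)
  have "linf_norm N (\<lambda>_. 0) \<le> 1" using assms(1) by (simp add: linf_norm_le_iff)
  then show "{l1_norm M (mat_app N u v) | v. linf_norm N v \<le> 1} \<noteq> {}" by blast
qed (use assms in \<open>auto simp: linf_norm_le_iff\<close>)

lemma op_norm_nonneg: "1 \<le> N \<Longrightarrow> 0 \<le> op_norm N M u"
  using op_norm_ge[of N "\<lambda>_. 0" M u] by (simp add: l1_norm_def mat_app_def)

text \<open>By duality the left side is a pairing of the coordinate sequences of \<open>v\<close>
  with suitable vectors, one per output index, to which the inner-product inequality
  applies.\<close>

lemma grothendieck_two_summing:
  assumes N: "1 \<le> N"
  shows "sqrt (\<Sum>k<n. (l1_norm M (mat_app N u (v k)))\<^sup>2) \<le> (8 * op_norm N M u) * weak_two_norm N n v"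
proof -
  let ?w = "weak_two_norm N n v" and ?L = "\<lambda>k. l1_norm M (mat_app N u (v k))"
  let ?S = "sqrt (\<Sum>k<n. (?L k)\<^sup>2)"
  have v: "(\<Sum>k<n. (v k i)\<^sup>2) \<le> ?w\<^sup>2" if "i \<in> {1..N}" for i
    using weak_two_norm_ge[OF that, of v n] by (simp add: sqrt_le_D)
  have L0: "0 \<le> ?L k" for k by (simp add: l1_norm_def sum_nonneg)
  have S0: "0 \<le> ?S" by (simp add: sum_nonneg)
  have w0: "0 \<le> ?w" by (rule weak_two_norm_nonneg[OF N])
  \<comment> \<open>Both \<open>?w\<close> and \<open>?S\<close> serve as normalising divisors
    below, so their zeros are treated first.\<close>
  consider "?w = 0" | "?S = 0" | "0 < ?w" "0 < ?S" using w0 S0 by linarith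
  then show ?thesis
  proof cases
    case 1
    then have "(\<Sum>k<n. (v k i)\<^sup>2) = 0" if "i \<in> {1..N}" for i
      using v[OF that] sum_nonneg[of "{..<n}" "\<lambda>k. (v k i)\<^sup>2"] by simp
    then have "v k i = 0" if "i \<in> {1..N}" "k < n" for i k
      using that by (simp add: sum_nonneg_eq_0_iff)
    then have "?S = 0" by (simp add: l1_norm_def mat_app_def)
    then show ?thesis using 1 by simp
  next
    case 2
    then show ?thesis using w0 op_norm_nonneg[OF N] by simp
  next
    case 3
    have S2: "?S\<^sup>2 = (\<Sum>k<n. (?L k)\<^sup>2)" by (simp add: sum_nonneg)
    \<comment> \<open>The dual witness: the signs recover the l1-norms and the weights
      \<open>?L k / ?S\<close> form a unit vector, so the pairing equals
      \<open>?S / ?w\<close>.\<close>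
    define y where "y j k = ?L k / ?S * sgn (mat_app N u (v k) j)" for j k
    have "(\<Sum>i\<in>{1..N}. \<Sum>j\<in>{1..M}. u j i * (\<Sum>k<n. (v k i / ?w) * y j k)) \<le> 8 * op_norm N M u"
    proof (rule grothendieck_inequality)
      fix a b :: "nat \<Rightarrow> real"
      assume a: "\<And>i. i \<in> {1..N} \<Longrightarrow> \<bar>a i\<bar> \<le> 1" and b: "\<And>j. j \<in> {1..M} \<Longrightarrow> \<bar>b j\<bar> \<le> 1"
      have "(\<Sum>i\<in>{1..N}. \<Sum>j\<in>{1..M}. u j i * (a i * b j)) = (\<Sum>j\<in>{1..M}. mat_app N u a j * b j)"
        by (subst sum.swap) (simp add: mat_app_def sum_distrib_right mult.assoc)
      also have "\<dots> \<le> (\<Sum>j\<in>{1..M}. \<bar>mat_app N u a j\<bar>)"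
      proof (rule sum_mono)
        fix j assume "j \<in> {1..M}"
        then have "\<bar>mat_app N u a j * b j\<bar> \<le> \<bar>mat_app N u a j\<bar>"
          using b by (auto simp: abs_mult intro: mult_left_le)
        then show "mat_app N u a j * b j \<le> \<bar>mat_app N u a j\<bar>" by linarith
      qed
      also have "\<dots> \<le> op_norm N M u" using op_norm_ge[OF N a] by (simp add: l1_norm_def)
      finally show "(\<Sum>i\<in>{1..N}. \<Sum>j\<in>{1..M}. u j i * (a i * b j)) \<le> op_norm N M u" .
    next
      fix i assume "i \<in> {1..N}"
      then show "(\<Sum>k<n. (v k i / ?w)\<^sup>2) \<le> 1"
        using v 3 by (simp add: power_divide sum_divide_distrib[symmetric] divide_le_eq)
    next
      fix j
      have "(\<Sum>k<n. (y j k)\<^sup>2) \<le> (\<Sum>k<n. (?L k)\<^sup>2 / ?S\<^sup>2)"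
      proof (rule sum_mono)
        fix k
        have "(sgn (mat_app N u (v k) j))\<^sup>2 \<le> 1" by (simp add: sgn_if)
        then show "(y j k)\<^sup>2 \<le> (?L k)\<^sup>2 / ?S\<^sup>2"
          unfolding y_def power_mult_distrib power_divide by (intro mult_left_le) auto
      qed
      also have "\<dots> = 1" using 3 S2 by (simp add: sum_divide_distrib[symmetric])
      finally show "(\<Sum>k<n. (y j k)\<^sup>2) \<le> 1" .
    qed
    also have "(\<Sum>i\<in>{1..N}. \<Sum>j\<in>{1..M}. u j i * (\<Sum>k<n. (v k i / ?w) * y j k))
        = (\<Sum>i\<in>{1..N}. \<Sum>j\<in>{1..M}. \<Sum>k<n. u j i * v k i * y j k) / ?w"
      by (simp add: sum_distrib_left sum_divide_distrib mult.assoc)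
    also have "(\<Sum>i\<in>{1..N}. \<Sum>j\<in>{1..M}. \<Sum>k<n. u j i * v k i * y j k)
        = (\<Sum>j\<in>{1..M}. \<Sum>i\<in>{1..N}. \<Sum>k<n. u j i * v k i * y j k)"
      by (rule sum.swap)
    also have "\<dots> = (\<Sum>j\<in>{1..M}. \<Sum>k<n. \<Sum>i\<in>{1..N}. u j i * v k i * y j k)"
      by (rule sum.cong[OF refl sum.swap])
    also have "\<dots> = (\<Sum>k<n. \<Sum>j\<in>{1..M}. \<Sum>i\<in>{1..N}. u j i * v k i * y j k)"
      by (rule sum.swap)
    also have "\<dots> = (\<Sum>k<n. \<Sum>j\<in>{1..M}. ?L k / ?S * \<bar>mat_app N u (v k) j\<bar>)"
    proof (rule sum.cong[OF refl], rule sum.cong[OF refl])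
      fix k j
      have "(\<Sum>i\<in>{1..N}. u j i * v k i * y j k) = mat_app N u (v k) j * y j k"
        by (simp add: mat_app_def sum_distrib_right)
      also have "\<dots> = ?L k / ?S * \<bar>mat_app N u (v k) j\<bar>" by (simp add: y_def abs_sgn)
      finally show "(\<Sum>i\<in>{1..N}. u j i * v k i * y j k) = ?L k / ?S * \<bar>mat_app N u (v k) j\<bar>" .
    qed
    also have "\<dots> = (\<Sum>k<n. (?L k)\<^sup>2) / ?S"
    proof -
      have "(\<Sum>j\<in>{1..M}. ?L k / ?S * \<bar>mat_app N u (v k) j\<bar>) = (?L k)\<^sup>2 / ?S" for k
        unfolding sum_distrib_left[symmetric] by (simp add: l1_norm_def power2_eq_square)
      then show ?thesis by (simp only: sum_divide_distrib)
    qed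
    also have "\<dots> = ?S" using 3 S2 by (simp add: power2_eq_square field_simps)
    finally show ?thesis using 3 by (simp add: divide_le_eq)
  qed
qed

lemma two_summing_norm_le_grothendieck:
  assumes "1 \<le> N"
  shows "two_summing_norm N M u \<le> 8 * op_norm N M u"
  unfolding two_summing_norm_def
  by (rule cInf_lower)
     (use op_norm_nonneg[OF assms] grothendieck_two_summing[OF assms] in \<open>auto intro!: bdd_belowI[of _ 0]\<close>)

text \<open>The infimum defining the 2-summing norm is itself admissible: divide by a positive weak
  norm, and let the constant \<open>8 * op_norm N M u\<close> force the left side to vanish when the
  weak norm is 0.\<close>

lemma two_summing_norm_bound:
  assumes N: "1 \<le> N"
  shows "sqrt (\<Sum>k<n. (l1_norm M (mat_app N u (v k)))\<^sup>2)
      \<le> two_summing_norm N M u * weak_two_norm N n v"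
proof -
  let ?C = "{C. 0 \<le> C \<and>
     (\<forall>n v. sqrt (\<Sum>k<n. (l1_norm M (mat_app N u (v k)))\<^sup>2) \<le> C * weak_two_norm N n v)}"
  have mem: "8 * op_norm N M u \<in> ?C"
    using op_norm_nonneg[OF N] grothendieck_two_summing[OF N] by auto
  show ?thesis
  proof (cases "weak_two_norm N n v = 0")
    case True
    then show ?thesis using grothendieck_two_summing[OF N, where n = n and v = v and M = M and u = u] by simp
  next
    case False
    then have w: "0 < weak_two_norm N n v" using weak_two_norm_nonneg[OF N, of n v] by simp
    have "sqrt (\<Sum>k<n. (l1_norm M (mat_app N u (v k)))\<^sup>2) / weak_two_norm N n v
        \<le> two_summing_norm N M u"
      unfolding two_summing_norm_def using mem w
      by (intro cInf_greatest) (blast, simp add: divide_le_eq)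
    then show ?thesis using w by (simp add: divide_le_eq)
  qed
qed

text \<open>CHSH has operator norm at most 2, while the two unit vectors have weak norm at most 1
  and images of l1-norm 2 each. Hence its 2-summing norm is at least
  \<open>2 * sqrt 2\<close>.\<close>

lemma grothendieck_bound_sqrt2:
  assumes "grothendieck_bound K"
  shows "sqrt 2 \<le> K"
proof -
  \<comment> \<open>the CHSH matrix\<close>
  define u :: "nat \<Rightarrow> nat \<Rightarrow> real" where "u j i = (if j = 2 \<and> i = 2 then -1 else 1)" for j i
  define e :: "nat \<Rightarrow> nat \<Rightarrow> real" where "e k i = (if i = Suc k then 1 else 0)" for k i
  have I2: "{1..2::nat} = {1, 2}" by auto
  have op: "op_norm 2 2 u \<le> 2"
  proof (rule op_norm_le)
    fix v :: "nat \<Rightarrow> real" assume "\<And>i. i \<in> {1..2} \<Longrightarrow> \<bar>v i\<bar> \<le> 1"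
    from this[of 1] this[of 2] show "l1_norm 2 (mat_app 2 u v) \<le> 2"
      unfolding l1_norm_def mat_app_def I2 by (simp add: u_def)
  qed simp
  have "weak_two_norm 2 2 e \<le> 1"
    by (rule weak_two_norm_le) (simp_all add: e_def lessThan_Suc numeral_2_eq_2)
  have l: "l1_norm 2 (mat_app 2 u (e k)) = 2" if "k < 2" for k
    using that unfolding l1_norm_def mat_app_def I2 by (auto simp: u_def e_def less_2_cases_iff)
  have ts: "two_summing_norm 2 2 u \<le> K * op_norm 2 2 u" using assms by (simp add: grothendieck_bound_def)
  have "2 * sqrt 2 = sqrt (\<Sum>k<2::nat. (l1_norm 2 (mat_app 2 u (e k)))\<^sup>2)"
    by (simp add: l real_sqrt_mult[of 4 2, simplified])
  also have "\<dots> \<le> two_summing_norm 2 2 u * weak_two_norm 2 2 e"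
    by (rule two_summing_norm_bound) simp
  finally have *: "2 * sqrt 2 \<le> two_summing_norm 2 2 u * weak_two_norm 2 2 e" .
  \<comment> \<open>Positivity of the products in \<open>*\<close> and \<open>**\<close> yields the
    signs of the 2-summing norm and of \<open>K\<close>, which monotonicity of multiplication
    requires.\<close>
  have "0 \<le> weak_two_norm 2 2 e" by (rule weak_two_norm_nonneg) simp
  moreover have "0 < 2 * sqrt 2" by simp
  ultimately have "0 \<le> two_summing_norm 2 2 u"
    using * by (smt (verit) mult_nonneg_nonpos2 mult.commute)
  then have "2 * sqrt 2 \<le> two_summing_norm 2 2 u"
    using * \<open>weak_two_norm 2 2 e \<le> 1\<close> by (meson mult_left_le order_trans)
  also note ts
  finally have **: "2 * sqrt 2 \<le> K * op_norm 2 2 u" .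
  have "0 \<le> op_norm 2 2 u" by (rule op_norm_nonneg) simp
  then have "0 \<le> K" using ** \<open>0 < 2 * sqrt 2\<close> by (smt (verit) mult_nonneg_nonpos2 mult.commute)
  then have "K * op_norm 2 2 u \<le> K * 2" using op by (rule mult_left_mono[rotated])
  with ** show ?thesis by simp
qed

lemma grothendieck_bound_8: "grothendieck_bound 8"
  unfolding grothendieck_bound_def using two_summing_norm_le_grothendieck by blast

lemma KG_ge_sqrt2: "sqrt 2 \<le> KG"
  unfolding KG_def using grothendieck_bound_8 grothendieck_bound_sqrt2 by (intro cInf_greatest) auto

lemma KG_pos: "0 < KG"
  using KG_ge_sqrt2 by (smt (verit) real_sqrt_gt_0_iff)

text \<open>The infimum \<open>KG\<close> is attained, by dividing by the operator norm. If that
  norm is 0, the constant 8 already gives a 2-summing norm at most 0.\<close>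

lemma grothendieck_bound_KG: "grothendieck_bound KG"
  unfolding grothendieck_bound_def
proof (intro allI impI)
  fix N M :: nat and u assume N: "1 \<le> N" "1 \<le> M"
  show "two_summing_norm N M u \<le> KG * op_norm N M u"
  proof (cases "op_norm N M u = 0")
    case True
    then show ?thesis using two_summing_norm_le_grothendieck[OF N(1), of M u] by simp
  next
    case False
    then have p: "0 < op_norm N M u" using op_norm_nonneg[OF N(1), of M u] by simp
    have "two_summing_norm N M u / op_norm N M u \<le> KG"
      unfolding KG_def using grothendieck_bound_8 N p
      by (intro cInf_greatest) (auto simp: grothendieck_bound_def divide_le_eq)
    then show ?thesis using p by (simp add: divide_le_eq)
  qed
qed

subsection \<open>Majority votes\<close>

text \<open>Unlike \<open>sgn\<close> this sends 0 to 1, so that a tied vote is still a legal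
  answer.\<close>

definition sg :: "real \<Rightarrow> real" where
  "sg s = (if 0 \<le> s then 1 else -1)"

text \<open>The correlation of one fair vote with the majority of \<open>n + 1\<close> independent
  ones, that is, the probability that it decides the outcome. The argument counts the other
  voters.\<close>

definition majority_corr :: "nat \<Rightarrow> real" where
  "majority_corr n = real (n choose (n div 2)) / 2 ^ n"

text \<open>Each subset of \<open>B\<close> is the trace of \<open>2 ^ (card I - card B)\<close>
  subsets of \<open>I\<close>: the signs outside \<open>B\<close> average out.\<close>

lemma sum_Pow_Int:
  fixes h :: "'a set \<Rightarrow> real"
  assumes "finite I" "B \<subseteq> I"
  shows "(\<Sum>A\<in>Pow I. h (A \<inter> B)) = 2 ^ (card I - card B) * (\<Sum>A\<in>Pow B. h A)"
proof -
  have *: "(\<Sum>A\<in>Pow (D \<union> B). h (A \<inter> B)) = 2 ^ card D * (\<Sum>A\<in>Pow B. h A)"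
    if "finite D" "finite B" "D \<inter> B = {}" for D
    using that
  proof (induction D rule: finite_induct)
    case empty
    have "(\<Sum>A\<in>Pow B. h (A \<inter> B)) = (\<Sum>A\<in>Pow B. h A)"
      by (intro sum.cong refl arg_cong[of _ _ h]) auto
    then show ?case by simp
  next
    case (insert a D)
    then have "(\<Sum>A\<in>Pow (insert a D \<union> B). h (A \<inter> B))
        = (\<Sum>A\<in>Pow (D \<union> B). h (A \<inter> B) + h (insert a A \<inter> B))"
      using sum_Pow_insert[of "D \<union> B" a "\<lambda>A. h (A \<inter> B)"] by simp
    also have "\<dots> = 2 * (\<Sum>A\<in>Pow (D \<union> B). h (A \<inter> B))"
      using insert.prems by (simp add: sum_distrib_left)
    finally show ?case using insert by simp
  qed
  have "finite B" using assms finite_subset by blast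
  then show ?thesis
    using *[of "I - B"] assms by (simp add: card_Diff_subset Un_absorb2 Int_commute[of "I - B"])
qed

text \<open>Multiplying independent uniform signs by fixed signs preserves their joint law. Here it
  removes Bob's answers from the vote count.\<close>

lemma sum_Pow_sgnf_twist:
  fixes h :: "real \<Rightarrow> real"
  assumes "finite B" "\<And>z. z \<in> B \<Longrightarrow> f z \<in> {-1, 1}"
  shows "(\<Sum>A\<in>Pow B. h (\<Sum>z\<in>B. f z * sgnf A z)) = (\<Sum>A\<in>Pow B. h (\<Sum>z\<in>B. sgnf A z))"
  using assms
proof (induction B arbitrary: h rule: finite_induct)
  case (insert a B)
  have f: "f a \<in> {-1, 1}" using insert.prems by blast
  have "(\<Sum>A\<in>Pow (insert a B). h (\<Sum>z\<in>insert a B. f z * sgnf A z))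
      = (\<Sum>A\<in>Pow B. h ((\<Sum>z\<in>B. f z * sgnf A z) - f a) + h ((\<Sum>z\<in>B. f z * sgnf A z) + f a))"
    by (rule sum_Pow_insert_sgnf[OF insert.hyps, of "\<lambda>s _. h s" f f])
  also have "\<dots> = (\<Sum>A\<in>Pow B. h ((\<Sum>z\<in>B. f z * sgnf A z) - 1) + h ((\<Sum>z\<in>B. f z * sgnf A z) + 1))"
    using f by (intro sum.cong refl) auto
  \<comment> \<open>The induction keeps \<open>h\<close> arbitrary so that its hypothesis applies to
    this sum of two translates.\<close>
  also have "\<dots> = (\<Sum>A\<in>Pow B. h ((\<Sum>z\<in>B. sgnf A z) - 1) + h ((\<Sum>z\<in>B. sgnf A z) + 1))"
    by (rule insert.IH[of "\<lambda>s. h (s - 1) + h (s + 1)"]) (use insert.prems in auto)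
  also have "\<dots> = (\<Sum>A\<in>Pow (insert a B). h (\<Sum>z\<in>insert a B. sgnf A z))"
    using sum_Pow_insert_sgnf[OF insert.hyps, of "\<lambda>s _. h s" "\<lambda>_. 1" "\<lambda>_. 1"] by simp
  finally show ?case .
qed simp

lemma sum_sgnf:
  assumes "finite B" "A \<subseteq> B"
  shows "(\<Sum>z\<in>B. sgnf A z) = 2 * real (card A) - real (card B)"
proof -
  have "(\<Sum>z\<in>B. sgnf A z) = (\<Sum>z\<in>B. 2 * indicator A z - 1)"
    by (intro sum.cong) (auto simp: sgnf_def)
  also have "\<dots> = 2 * real (card A) - real (card B)"
    using assms by (simp add: sum_subtractf sum_distrib_left[symmetric] indicator_def Int_absorb1
        Collect_mem_eq sum.If_cases)
  finally show ?thesis .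
qed

text \<open>Flipping the sign at \<open>x\<close> changes the vote only if the other votes sum to \<open>0\<close> or \<open>-1\<close>.\<close>

lemma majority_correlation:
  assumes I: "finite I" "B \<subseteq> I" "x \<in> B" and f: "\<And>z. z \<in> B \<Longrightarrow> f z \<in> {-1, 1}"
  shows "(\<Sum>A\<in>Pow I. f x * sgnf A x * sg (\<Sum>z\<in>B. f z * sgnf A z))
       = 2 ^ card I * majority_corr (card B - 1)"
proof -
  define C where "C = B - {x}"
  have B: "B = insert x C" "x \<notin> C" using I by (auto simp: C_def)
  have fin: "finite B" "finite C" using I finite_subset by (auto simp: C_def)
  define n where "n = card C"
  have n: "card B = Suc n" using B fin by (simp add: n_def)
  have fx: "f x \<in> {-1, 1}" using f I by blast
  define g :: "real \<Rightarrow> real" where "g s = sg (s + 1) - sg (s - 1)" for s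
  have "(\<Sum>A\<in>Pow I. f x * sgnf A x * sg (\<Sum>z\<in>B. f z * sgnf A z))
      = (\<Sum>A\<in>Pow I. f x * sgnf (A \<inter> B) x * sg (\<Sum>z\<in>B. f z * sgnf (A \<inter> B) z))"
    using I by (intro sum.cong refl arg_cong2[of _ _ _ _ "(*)"] arg_cong[of _ _ sg]) (auto simp: sgnf_def)
  also have "\<dots> = 2 ^ (card I - card B) * (\<Sum>A\<in>Pow B. f x * sgnf A x * sg (\<Sum>z\<in>B. f z * sgnf A z))"
    by (rule sum_Pow_Int[OF I(1,2)])
  also have "(\<Sum>A\<in>Pow B. f x * sgnf A x * sg (\<Sum>z\<in>B. f z * sgnf A z))
      = (\<Sum>A\<in>Pow C. f x * sg ((\<Sum>z\<in>C. f z * sgnf A z) + f x) - f x * sg ((\<Sum>z\<in>C. f z * sgnf A z) - f x))"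
  proof -
    have e: "(\<Sum>z\<in>C. f z * sgnf (insert x A) z) = (\<Sum>z\<in>C. f z * sgnf A z)" for A
      using B by (intro sum.cong) (auto simp: sgnf_def)
    show ?thesis
      unfolding B sum_Pow_insert[OF fin(2) B(2)] using B fin
      by (intro sum.cong refl) (auto simp: e sgnf_def[of _ x] add.commute)
  qed
  also have "\<dots> = (\<Sum>A\<in>Pow C. g (\<Sum>z\<in>C. f z * sgnf A z))"
    using fx by (intro sum.cong refl) (auto simp: g_def)
  also have "\<dots> = (\<Sum>A\<in>Pow C. g (\<Sum>z\<in>C. sgnf A z))"
    by (rule sum_Pow_sgnf_twist[OF fin(2)]) (use f C_def in auto)
  also have "\<dots> = (\<Sum>A\<in>Pow C. if card A = n div 2 then 2 else 0)"
  proof (intro sum.cong refl)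
    fix A assume "A \<in> Pow C"
    then have s: "(\<Sum>z\<in>C. sgnf A z) = real_of_int (2 * int (card A) - int n)"
      using sum_sgnf[of C A] fin by (simp add: n_def)
    \<comment> \<open>The vote count has the parity of \<open>n\<close>, so exactly one of the
      values 0 and -1 can occur, namely when \<open>card A = n div 2\<close>.\<close>
    have "g (real_of_int i) = (if i = 0 \<or> i = -1 then 2 else 0)" for i :: int
      by (auto simp: g_def sg_def)
    moreover have "2 * int (card A) - int n = 0 \<or> 2 * int (card A) - int n = -1 \<longleftrightarrow> card A = n div 2"
      by presburger
    ultimately show "g (\<Sum>z\<in>C. sgnf A z) = (if card A = n div 2 then 2 else 0)"
      unfolding s by (simp only:)
  qed
  also have "\<dots> = 2 * real (n choose (n div 2))"
  proof -
    have "{A \<in> Pow C. card A = n div 2} = {A. A \<subseteq> C \<and> card A = n div 2}" by auto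
    then show ?thesis
      using n_subsets[OF fin(2), of "n div 2"] fin by (simp add: sum.If_cases n_def Int_def)
  qed
  also have "2 ^ (card I - card B) * (2 * real (n choose (n div 2))) = 2 ^ card I * majority_corr n"
  proof -
    have "card B \<le> card I" using I by (intro card_mono)
    then have "(2::real) ^ card I = 2 ^ (card I - card B) * 2 ^ Suc n"
      using n by (simp flip: power_add power_Suc)
    then show ?thesis by (simp add: majority_corr_def)
  qed
  finally show ?thesis using n by simp
qed

section \<open>Estimates for central binomial coefficients and balanced blocks\<close>

lemma central_binomial_Suc:
  "real (Suc k) * real (2 * Suc k choose Suc k) = 2 * real (2 * k + 1) * real (2 * k choose k)"
proof -
  have "Suc k * (Suc (Suc (2 * k)) choose Suc k) = Suc (Suc (2 * k)) * (Suc (2 * k) choose k)"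
    by (metis Suc_times_binomial_eq mult.commute)
  also have "Suc (2 * k) choose k = Suc (2 * k) choose Suc k"
    using binomial_symmetric[of k "Suc (2 * k)"] by (simp add: Suc_diff_le)
  finally have 1: "Suc k * (2 * Suc k choose Suc k) = 2 * Suc k * (Suc (2 * k) choose Suc k)" by simp
  have 2: "Suc k * (Suc (2 * k) choose Suc k) = Suc (2 * k) * (2 * k choose k)"
    by (metis Suc_times_binomial_eq mult.commute)
  have "Suc k * (2 * Suc k choose Suc k) = 2 * (2 * k + 1) * (2 * k choose k)"
    using 1 2 by simp
  then show ?thesis by (metis of_nat_mult of_nat_numeral)
qed

lemma majority_corr_even_Suc:
  "majority_corr (2 * Suc k) = majority_corr (2 * k) * real (2 * k + 1) / real (2 * k + 2)"
proof -
  have "real (2 * Suc k choose Suc k) = 2 * real (2 * k + 1) * real (2 * k choose k) / real (Suc k)"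
    using central_binomial_Suc[of k] by (simp add: eq_divide_eq mult.commute del: of_nat_Suc)
  moreover have "2 * real (2 * k + 1) * C / K / (4 * P) = C / P * real (2 * k + 1) / (2 * K)"
    for C P K :: real by (simp add: divide_simps)
  moreover have "real (2 * k + 2) = 2 * real (Suc k)" "(2::real) ^ (2 * Suc k) = 4 * 2 ^ (2 * k)"
    by simp_all
  ultimately show ?thesis
    unfolding majority_corr_def by (simp only: nonzero_mult_div_cancel_left[of 2] zero_neq_numeral[symmetric] simp_thms)
qed

text \<open>By Pascal's rule and symmetry the middle coefficient doubles together with the
  denominator, so it suffices to estimate even arguments.\<close>

lemma majority_corr_odd: "majority_corr (2 * k + 1) = majority_corr (2 * Suc k)"
proof -
  have "2 * Suc k choose Suc k = (Suc (2 * k) choose k) + (Suc (2 * k) choose Suc k)" by simp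
  also have "Suc (2 * k) choose k = Suc (2 * k) choose Suc k"
    using binomial_symmetric[of k "Suc (2 * k)"] by (simp add: Suc_diff_le)
  finally have "2 * Suc k choose Suc k = 2 * (Suc (2 * k) choose k)"
    using binomial_symmetric[of k "Suc (2 * k)"] by (simp add: Suc_diff_le)
  then show ?thesis by (simp add: majority_corr_def)
qed

lemma majority_corr_nonneg: "0 \<le> majority_corr n"
  by (simp add: majority_corr_def)

text \<open>The right side equals 1 at \<open>k = 0\<close> and never decreases: with j = k + 1,
  consecutive values have ratio (2j + 1)^2 / (4j(j + 1)).\<close>

lemma majority_corr_even_ge: "1 \<le> 4 * real (Suc k) * (majority_corr (2 * Suc k))\<^sup>2"
proof (induction k)
  case 0
  then show ?case by (simp add: majority_corr_def power2_eq_square numeral_2_eq_2)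
next
  case (Suc k)
  let ?c = "majority_corr (2 * Suc k)"
  let ?k = "real (Suc k)"
  have "1 \<le> 4 * ?k * ?c\<^sup>2" by (rule Suc.IH)
  also have "\<dots> \<le> 4 * ?k * ?c\<^sup>2 * ((2 * ?k + 1)\<^sup>2 / (4 * ?k * (?k + 1)))"
  proof -
    have "1 \<le> (2 * ?k + 1)\<^sup>2 / (4 * ?k * (?k + 1))"
      by (subst le_divide_eq_1_pos) (simp_all add: power2_eq_square algebra_simps add_pos_nonneg)
    then have "4 * ?k * ?c\<^sup>2 * 1 \<le> 4 * ?k * ?c\<^sup>2 * ((2 * ?k + 1)\<^sup>2 / (4 * ?k * (?k + 1)))"
      by (intro mult_left_mono) auto
    then show ?thesis by simp
  qed
  also have "\<dots> = 4 * (?k + 1) * (?c * (2 * ?k + 1) / (2 * ?k + 2))\<^sup>2"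
  proof -
    have "2 * ?k + 2 = 2 * (?k + 1)" by simp
    moreover have "0 < ?k" "0 < ?k + 1" by auto
    ultimately show ?thesis
      by (simp only: power_divide power_mult_distrib) (simp add: divide_simps power2_eq_square)
  qed
  also have "?c * (2 * ?k + 1) / (2 * ?k + 2) = majority_corr (2 * Suc (Suc k))"
    using majority_corr_even_Suc[of "Suc k"] by (simp add: algebra_simps)
  finally show ?case by (simp add: algebra_simps)
qed

text \<open>The right side adds R(n) = \<open>n * majority_corr (n - 1)\<close> over
  \<open>r\<close> blocks of size \<open>q + 1\<close> and \<open>m - r\<close> of size
  \<open>q\<close>. R grows from an even size to the next and is constant from an odd size to the
  next, hence the split by parity.\<close>

lemma balanced_majority_ge:
  assumes "1 \<le> q" "r \<le> m"
  shows "sqrt (real m * real (q * m + r) / 2)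
     \<le> real r * real (q + 1) * majority_corr q + real (m - r) * real q * majority_corr (q - 1)"
proof (cases "m = 0")
  case False
  \<comment> \<open>Dividing by \<open>m\<close> leaves a linear interpolation between R(q) and R(q
    + 1), with weight \<open>\<theta>\<close> on the larger blocks.\<close>
  define \<theta> where "\<theta> = real r / real m"
  have m: "0 < real m" using False by simp
  have \<theta>: "0 \<le> \<theta>" "\<theta> \<le> 1" using assms m by (auto simp: \<theta>_def divide_le_eq)
  have r: "real r = \<theta> * real m" "real (m - r) = (1 - \<theta>) * real m"
    using m assms by (auto simp: \<theta>_def of_nat_diff algebra_simps)
  have "sqrt ((real q + \<theta>) / 2)
      \<le> \<theta> * real (q + 1) * majority_corr q + (1 - \<theta>) * real q * majority_corr (q - 1)"
  proof (cases "even q")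
    case True
    then obtain j where "q = 2 * j" by blast
    then obtain k where q: "q = 2 * Suc k" using assms by (cases j) auto
    let ?c = "majority_corr (2 * Suc k)" and ?k = "real (Suc k)"
    have c: "majority_corr (q - 1) = ?c" using majority_corr_odd[of k] q by simp
    have "(real q + \<theta>) / 2 = ?k * (1 + \<theta> / (2 * ?k))" using q by (simp add: field_simps)
    \<comment> \<open>Squaring a factor that is at least 1 makes the bound a perfect square after
      the next step.\<close>
    also have "\<dots> \<le> ?k * (1 + \<theta> / (2 * ?k))\<^sup>2"
      using \<theta> by (intro mult_left_mono) (auto simp: power2_eq_square mult_le_cancel_left1)
    also have "\<dots> \<le> ?k * (1 + \<theta> / (2 * ?k))\<^sup>2 * (4 * ?k * ?c\<^sup>2)"
      using mult_left_mono[OF majority_corr_even_ge[of k], of "?k * (1 + \<theta> / (2 * ?k))\<^sup>2"] by simp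
    also have "\<dots> = (2 * ?k * ?c * (1 + \<theta> / (2 * ?k)))\<^sup>2"
      by (simp only: power_mult_distrib) (simp add: power2_eq_square)
    finally have "sqrt ((real q + \<theta>) / 2) \<le> 2 * ?k * ?c * (1 + \<theta> / (2 * ?k))"
      using \<theta> majority_corr_nonneg[of "2 * Suc k"] by (intro real_le_lsqrt) auto
    also have "\<dots> = \<theta> * real (q + 1) * majority_corr q + (1 - \<theta>) * real q * majority_corr (q - 1)"
      unfolding c unfolding q by (simp add: field_simps)
    finally show ?thesis .
  next
    case False
    then obtain k where q: "q = 2 * k + 1" by (rule oddE)
    let ?c = "majority_corr (2 * k)" and ?c' = "majority_corr (2 * Suc k)" and ?k = "real (Suc k)"
    have c: "majority_corr q = ?c'" "majority_corr (q - 1) = ?c"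
      using majority_corr_odd[of k] q by simp_all
    \<comment> \<open>The interpolation is constant for odd \<open>q\<close>, so it is compared with
      the extreme case \<open>\<theta> = 1\<close>.\<close>
    have "(real q + \<theta>) / 2 \<le> ?k" using q \<theta> by simp
    also have "\<dots> \<le> ?k * (4 * ?k * ?c'\<^sup>2)"
      using majority_corr_even_ge[of k] by (simp add: mult_le_cancel_left1)
    also have "\<dots> = (2 * ?k * ?c')\<^sup>2" by (simp add: power2_eq_square algebra_simps)
    finally have "sqrt ((real q + \<theta>) / 2) \<le> 2 * ?k * ?c'"
      using majority_corr_nonneg[of "2 * Suc k"] by (intro real_le_lsqrt) auto
    also have "\<dots> = \<theta> * real (q + 1) * majority_corr q + (1 - \<theta>) * real q * majority_corr (q - 1)"
    proof -
      have "real q * ?c = 2 * ?k * ?c'"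
        unfolding majority_corr_even_Suc q by (simp add: field_simps)
      moreover have "real (q + 1) * ?c' = 2 * ?k * ?c'" using q by simp
      ultimately show ?thesis unfolding c
        by (metis (no_types, opaque_lifting) add.commute diff_add_cancel distrib_right mult.assoc mult_1)
    qed
    finally show ?thesis .
  qed
  then have "real m * sqrt ((real q + \<theta>) / 2)
     \<le> real m * (\<theta> * real (q + 1) * majority_corr q + (1 - \<theta>) * real q * majority_corr (q - 1))"
    using m by (intro mult_left_mono) auto
  also have "\<dots> = real r * real (q + 1) * majority_corr q + real (m - r) * real q * majority_corr (q - 1)"
    unfolding r by (simp add: algebra_simps)
  also have "real m * sqrt ((real q + \<theta>) / 2) = sqrt ((real m)\<^sup>2 * ((real q + \<theta>) / 2))"
    unfolding real_sqrt_mult[of "(real m)\<^sup>2"] by simp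
  also have "(real m)\<^sup>2 * ((real q + \<theta>) / 2) = real m * real (q * m + r) / 2"
    using r by (simp add: power2_eq_square algebra_simps)
  finally show ?thesis .
qed (use assms in simp)

lemma card_mod_eq:
  assumes "t < (m::nat)" "r < m"
  shows "card {z. z < q * m + r \<and> z mod m = t} = q + (if t < r then 1 else 0)"
proof -
  have "{z. z < q * m + r \<and> z mod m = t} = (\<lambda>i. i * m + t) ` {..<q + (if t < r then 1 else 0)}"
  proof (intro set_eqI iffI)
    fix z assume "z \<in> {z. z < q * m + r \<and> z mod m = t}"
    then have z: "z < q * m + r" "z mod m = t" by auto
    have "z = z div m * m + t" using z by (metis div_mult_mod_eq)
    moreover have "z div m < q + (if t < r then 1 else 0)"
    proof (rule ccontr)
      assume "\<not> z div m < q + (if t < r then 1 else 0)"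
      then have "(q + (if t < r then 1 else 0)) * m \<le> z div m * m" by (intro mult_le_mono1) simp
      then show False using \<open>z = z div m * m + t\<close> z assms
        by (simp add: algebra_simps split: if_splits)
    qed
    ultimately show "z \<in> (\<lambda>i. i * m + t) ` {..<q + (if t < r then 1 else 0)}" by blast
  next
    fix z assume "z \<in> (\<lambda>i. i * m + t) ` {..<q + (if t < r then 1 else 0)}"
    then obtain i where i: "z = i * m + t" "i < q + (if t < r then 1 else 0)" by blast
    have "i * m + t < q * m + r"
    proof (cases "i < q")
      case True
      then have "Suc i * m \<le> q * m" by (intro mult_le_mono1) simp
      then show ?thesis using assms by simp
    next
      case False
      then have "i = q" "t < r" using i by (auto split: if_splits)
      then show ?thesis by simp
    qed
    then show "z \<in> {z. z < q * m + r \<and> z mod m = t}" using i assms by simp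
  qed
  moreover have "inj_on (\<lambda>i. i * m + t) {..<q + (if t < r then 1 else 0)}"
    using assms by (auto simp: inj_on_def)
  ultimately show ?thesis by (simp add: card_image)
qed

text \<open>Grouping by residues modulo \<open>m\<close> gives \<open>N mod m\<close> classes of
  size \<open>N div m + 1\<close>, the others having size \<open>N div m\<close>.\<close>

lemma sum_majority_blocks_ge:
  assumes "0 < m" "m \<le> N"
  shows "sqrt (real m * real N / 2)
    \<le> (\<Sum>z<N. majority_corr (card {z'. z' < N \<and> z' mod m = z mod m} - 1))"
proof -
  define q r where "q = N div m" and "r = N mod m"
  have N: "N = q * m + r" and r: "r < m" and q: "1 \<le> q"
    using assms by (auto simp: q_def r_def div_greater_zero_iff Suc_le_eq)
  define c where "c t = card {z'. z' < N \<and> z' mod m = t}" for t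
  have c: "c t = q + (if t < r then 1 else 0)" if "t < m" for t
    unfolding c_def N using that r by (rule card_mod_eq)
  have "(\<Sum>z<N. majority_corr (c (z mod m) - 1))
      = (\<Sum>t<m. \<Sum>z\<in>{z \<in> {..<N}. z mod m = t}. majority_corr (c (z mod m) - 1))"
    by (rule sum.group[symmetric]) (use assms in auto)
  also have "\<dots> = (\<Sum>t<m. real (c t) * majority_corr (c t - 1))"
    by (intro sum.cong refl) (simp add: c_def)
  also have "\<dots> = (\<Sum>t<m. if t < r then real (q + 1) * majority_corr q else real q * majority_corr (q - 1))"
    by (intro sum.cong refl) (simp add: c)
  also have "\<dots> = real r * real (q + 1) * majority_corr q + real (m - r) * real q * majority_corr (q - 1)"
  proof -
    have "{..<m} \<inter> {t. t < r} = {..<r}" "{..<m} \<inter> - {t. t < r} = {r..<m}" using r by auto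
    then show ?thesis by (simp add: sum.If_cases)
  qed
  also have "\<dots> \<ge> sqrt (real m * real (q * m + r) / 2)"
    by (rule balanced_majority_ge) (use q r in auto)
  finally show ?thesis using N by (simp add: c_def)
qed

subsection \<open>Values of XOR games\<close>

lemma sg_values [simp]: "sg s \<in> {-1, 1}"
  by (simp add: sg_def)

lemma mult_sg: "s * sg s = \<bar>s\<bar>"
  by (simp add: sg_def)

lemma classical_value_ge:
  assumes "\<And>x. x \<in> {1..N} \<Longrightarrow> a x \<in> {-1, 1}" "\<And>y. y \<in> {1..N} \<Longrightarrow> b y \<in> {-1, 1}"
  shows "(\<Sum>x\<in>{1..N}. \<Sum>y\<in>{1..N}. G x y * a x * b y) \<le> classical_value N G"
  unfolding classical_value_def
proof (rule Max_ge)
  show "finite ((\<lambda>(a, b). \<Sum>x\<in>{1..N}. \<Sum>y\<in>{1..N}. G x y * a x * b y) `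
            (({1..N} \<rightarrow>\<^sub>E {-1, 1}) \<times> ({1..N} \<rightarrow>\<^sub>E {-1, 1})))"
    by (intro finite_imageI finite_cartesian_product finite_PiE) auto
  show "(\<Sum>x\<in>{1..N}. \<Sum>y\<in>{1..N}. G x y * a x * b y) \<in>
      (\<lambda>(a, b). \<Sum>x\<in>{1..N}. \<Sum>y\<in>{1..N}. G x y * a x * b y) `
            (({1..N} \<rightarrow>\<^sub>E {-1, 1}) \<times> ({1..N} \<rightarrow>\<^sub>E {-1, 1}))"
    by (rule image_eqI[of _ _ "(restrict a {1..N}, restrict b {1..N})"])
       (use assms in \<open>auto intro!: sum.cong\<close>)
qed

lemma classical_value_le:
  assumes "\<And>a b. (\<And>x. x \<in> {1..N} \<Longrightarrow> a x \<in> {-1, 1}) \<Longrightarrow> (\<And>y. y \<in> {1..N} \<Longrightarrow> b y \<in> {-1, 1}) \<Longrightarrow>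
    (\<Sum>x\<in>{1..N}. \<Sum>y\<in>{1..N}. G x y * a x * b y) \<le> B"
  shows "classical_value N G \<le> B"
  unfolding classical_value_def
proof (rule Max.boundedI)
  show "finite ((\<lambda>(a, b). \<Sum>x\<in>{1..N}. \<Sum>y\<in>{1..N}. G x y * a x * b y) `
            (({1..N} \<rightarrow>\<^sub>E {-1, 1}) \<times> ({1..N} \<rightarrow>\<^sub>E {-1, 1})))"
    by (intro finite_imageI finite_cartesian_product finite_PiE) auto
  show "(\<lambda>(a, b). \<Sum>x\<in>{1..N}. \<Sum>y\<in>{1..N}. G x y * a x * b y) `
            (({1..N} \<rightarrow>\<^sub>E {-1, 1}) \<times> ({1..N} \<rightarrow>\<^sub>E {-1, 1 :: real})) \<noteq> {}"
    by (simp add: PiE_eq_empty_iff)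
  fix v assume "v \<in> (\<lambda>(a, b). \<Sum>x\<in>{1..N}. \<Sum>y\<in>{1..N}. G x y * a x * b y) `
            (({1..N} \<rightarrow>\<^sub>E {-1, 1}) \<times> ({1..N} \<rightarrow>\<^sub>E {-1, 1}))"
  then obtain a b where "v = (\<Sum>x\<in>{1..N}. \<Sum>y\<in>{1..N}. G x y * a x * b y)"
    "a \<in> {1..N} \<rightarrow>\<^sub>E {-1, 1}" "b \<in> {1..N} \<rightarrow>\<^sub>E {-1, 1}" by auto
  then show "v \<le> B" using assms[of a b] by (metis PiE_mem)
qed

text \<open>A bilinear form on a product of cubes is maximised at vertices: first Bob's signs
  realise the l1-norm, then Alice's signs replace the entries of \<open>v\<close>.\<close>

lemma op_norm_le_classical_value:
  assumes N: "1 \<le> N"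
  shows "op_norm N N (\<lambda>y x. G x y) \<le> classical_value N G"
proof (rule op_norm_le[OF N])
  fix v :: "nat \<Rightarrow> real" assume v: "\<And>i. i \<in> {1..N} \<Longrightarrow> \<bar>v i\<bar> \<le> 1"
  define b where "b y = sg (mat_app N (\<lambda>y x. G x y) v y)" for y
  define a where "a x = sg (\<Sum>y\<in>{1..N}. G x y * b y)" for x
  have "l1_norm N (mat_app N (\<lambda>y x. G x y) v) = (\<Sum>y\<in>{1..N}. \<Sum>x\<in>{1..N}. G x y * v x * b y)"
    unfolding l1_norm_def mult_sg[symmetric] b_def[symmetric] by (simp add: mat_app_def sum_distrib_right)
  also have "\<dots> = (\<Sum>x\<in>{1..N}. v x * (\<Sum>y\<in>{1..N}. G x y * b y))"
    by (subst sum.swap) (simp only: sum_distrib_left mult_ac)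
  also have "\<dots> \<le> (\<Sum>x\<in>{1..N}. \<bar>\<Sum>y\<in>{1..N}. G x y * b y\<bar>)"
  proof (rule sum_mono)
    fix x assume "x \<in> {1..N}"
    then have "\<bar>v x * (\<Sum>y\<in>{1..N}. G x y * b y)\<bar> \<le> \<bar>\<Sum>y\<in>{1..N}. G x y * b y\<bar>"
      unfolding abs_mult using v by (intro mult_left_le_one_le) auto
    then show "v x * (\<Sum>y\<in>{1..N}. G x y * b y) \<le> \<bar>\<Sum>y\<in>{1..N}. G x y * b y\<bar>" by linarith
  qed
  also have "\<dots> = (\<Sum>x\<in>{1..N}. \<Sum>y\<in>{1..N}. G x y * a x * b y)"
    unfolding mult_sg[symmetric] a_def[symmetric] by (simp add: sum_distrib_left mult_ac)
  also have "\<dots> \<le> classical_value N G"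
    by (rule classical_value_ge) (simp_all only: a_def b_def sg_values)
  finally show "l1_norm N (mat_app N (\<lambda>y x. G x y) v) \<le> classical_value N G" .
qed

section \<open>The upper bound on one-way payoffs\<close>

lemma two_powr_half: "2 powr (real c / 2) = sqrt (2 ^ c)"
  by (simp add: powr_half_sqrt[symmetric] powr_realpow[symmetric] powr_powr)

definition deterministic_strategy ::
  "nat \<Rightarrow> nat \<Rightarrow> (nat \<Rightarrow> nat) \<Rightarrow> (nat \<Rightarrow> real) \<Rightarrow> (nat \<Rightarrow> nat \<Rightarrow> real) \<Rightarrow> bool" where
  "deterministic_strategy c N T \<alpha> \<beta> \<longleftrightarrow>
     (\<forall>x\<in>{1..N}. T x \<in> {1..2 ^ c}) \<and> (\<forall>x\<in>{1..N}. \<alpha> x \<in> {-1, 1}) \<and>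
     (\<forall>y\<in>{1..N}. \<forall>t\<in>{1..2 ^ c}. \<beta> y t \<in> {-1, 1})"

definition deterministic_payoff ::
  "nat \<Rightarrow> (nat \<Rightarrow> nat \<Rightarrow> real) \<Rightarrow> (nat \<Rightarrow> nat) \<Rightarrow> (nat \<Rightarrow> real) \<Rightarrow> (nat \<Rightarrow> nat \<Rightarrow> real) \<Rightarrow> real" where
  "deterministic_payoff N G T \<alpha> \<beta> = (\<Sum>x\<in>{1..N}. \<Sum>y\<in>{1..N}. G x y * (\<alpha> x * \<beta> y (T x)))"

lemma deterministic_payoff_le:
  assumes N: "1 \<le> N" and strat: "deterministic_strategy c N T \<alpha> \<beta>"
  shows "deterministic_payoff N G T \<alpha> \<beta> \<le> KG * 2 powr (real c / 2) * classical_value N G"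
proof -
  let ?n = "(2::nat) ^ c"
  have T: "T x \<in> {1..2 ^ c}" and \<alpha>: "\<alpha> x \<in> {-1, 1}" if "x \<in> {1..N}" for x
    using strat that by (auto simp: deterministic_strategy_def)
  have \<beta>: "\<beta> y t \<in> {-1, 1}" if "y \<in> {1..N}" "t \<in> {1..2 ^ c}" for y t
    using strat that by (auto simp: deterministic_strategy_def)
  define u where "u = (\<lambda>y x. G x y)"
  \<comment> \<open>Messages start at 1 but vectors are indexed from 0, hence
    \<open>Suc k\<close>.\<close>
  define v where "v k x = (if T x = Suc k then \<alpha> x else 0)" for k x
  define L where "L k = l1_norm N (mat_app N u (v k))" for k
  have pick: "(\<Sum>k<?n. v k x * g (Suc k)) = \<alpha> x * g (T x)" if x: "x \<in> {1..N}" for x and g :: "nat \<Rightarrow> real"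
  proof -
    obtain k where k: "T x = Suc k" "k < ?n" using T[OF x] by (cases "T x") auto
    have "(\<Sum>j<?n. v j x * g (Suc j)) = (\<Sum>j<?n. if j = k then \<alpha> x * g (Suc k) else 0)"
      using k by (intro sum.cong) (auto simp: v_def)
    then show ?thesis using k by simp
  qed
  \<comment> \<open>Each input sends exactly one message, so a single term is nonzero. The weak norm
    therefore does not grow with the number of messages.\<close>
  have "(\<Sum>k<?n. (v k x)\<^sup>2) \<le> 1\<^sup>2" if x: "x \<in> {1..N}" for x
  proof -
    obtain k where k: "T x = Suc k" "k < ?n" using T[OF x] by (cases "T x") auto
    have "(\<Sum>j<?n. (v j x)\<^sup>2) = (\<Sum>j<?n. if j = k then 1 else 0)"
      using k \<alpha>[OF x] by (intro sum.cong) (auto simp: v_def)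
    then show ?thesis using k by simp
  qed
  then have weak: "weak_two_norm N ?n v \<le> 1" by (intro weak_two_norm_le[OF N]) auto
  have "deterministic_payoff N G T \<alpha> \<beta>
      = (\<Sum>x\<in>{1..N}. \<Sum>y\<in>{1..N}. \<Sum>k<?n. G x y * v k x * \<beta> y (Suc k))"
    unfolding deterministic_payoff_def
    by (intro sum.cong refl) (simp add: pick[symmetric] sum_distrib_left mult.assoc)
  also have "\<dots> = (\<Sum>x\<in>{1..N}. \<Sum>k<?n. \<Sum>y\<in>{1..N}. G x y * v k x * \<beta> y (Suc k))"
    by (rule sum.cong[OF refl sum.swap])
  also have "\<dots> = (\<Sum>k<?n. \<Sum>x\<in>{1..N}. \<Sum>y\<in>{1..N}. G x y * v k x * \<beta> y (Suc k))"
    by (rule sum.swap)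
  also have "\<dots> \<le> (\<Sum>k<?n. L k)"
  proof (rule sum_mono)
    fix k assume k: "k \<in> {..<?n}"
    have "(\<Sum>x\<in>{1..N}. \<Sum>y\<in>{1..N}. G x y * v k x * \<beta> y (Suc k))
        = (\<Sum>y\<in>{1..N}. mat_app N u (v k) y * \<beta> y (Suc k))"
      by (subst sum.swap) (simp add: mat_app_def u_def sum_distrib_right)
    also have "\<dots> \<le> (\<Sum>y\<in>{1..N}. \<bar>mat_app N u (v k) y\<bar>)"
    proof (rule sum_mono)
      fix y assume "y \<in> {1..N}"
      then have "\<beta> y (Suc k) \<in> {-1, 1}" using k by (intro \<beta>) auto
      then show "mat_app N u (v k) y * \<beta> y (Suc k) \<le> \<bar>mat_app N u (v k) y\<bar>" by auto
    qed
    finally show "(\<Sum>x\<in>{1..N}. \<Sum>y\<in>{1..N}. G x y * v k x * \<beta> y (Suc k)) \<le> L k"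
      by (simp add: L_def l1_norm_def)
  qed
  also have "\<dots> \<le> sqrt (2 ^ c) * sqrt (\<Sum>k<?n. (L k)\<^sup>2)"
    unfolding real_sqrt_mult[symmetric]
    using Cauchy_Schwarz_ineq_sum[of "\<lambda>_. 1" L "{..<?n}"] by (intro real_le_rsqrt) simp
  also have "\<dots> \<le> sqrt (2 ^ c) * (KG * classical_value N G)"
  proof (rule mult_left_mono)
    have 0: "0 \<le> op_norm N N u" by (rule op_norm_nonneg[OF N])
    have "two_summing_norm N N u \<le> KG * op_norm N N u"
      using grothendieck_bound_KG N by (simp add: grothendieck_bound_def)
    then have "two_summing_norm N N u * weak_two_norm N ?n v \<le> KG * op_norm N N u * 1"
      using weak weak_two_norm_nonneg[OF N, of ?n v] 0 KG_pos by (intro mult_mono) auto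
    also have "\<dots> \<le> KG * classical_value N G"
      using op_norm_le_classical_value[OF N, of G] KG_pos by (simp add: u_def)
    finally show "sqrt (\<Sum>k<?n. (L k)\<^sup>2) \<le> KG * classical_value N G"
      using two_summing_norm_bound[OF N, where n = ?n and v = v and M = N and u = u]
      unfolding L_def by linarith
  qed simp
  finally show ?thesis by (simp add: two_powr_half mult_ac)
qed

text \<open>Freezing the shared randomness leaves a deterministic strategy, so the payoff is an
  average of numbers at most \<open>B\<close>. The work lies in integrability.\<close>

lemma one_way_payoff_le:
  assumes strat: "one_way_strategy c N M T \<alpha> \<beta>"
    and det: "\<And>T \<alpha> \<beta>. deterministic_strategy c N T \<alpha> \<beta> \<Longrightarrow> deterministic_payoff N G T \<alpha> \<beta> \<le> B"
  shows "one_way_payoff N G M T \<alpha> \<beta> \<le> B"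
proof -
  interpret prob_space M using strat by (simp add: one_way_strategy_def)
  have T: "T x \<in> M \<rightarrow>\<^sub>M count_space {1..2 ^ c}"
    and \<alpha>: "\<alpha> x \<in> M \<rightarrow>\<^sub>M count_space {-1, 1}" if "x \<in> {1..N}" for x
    using strat that by (auto simp: one_way_strategy_def)
  have \<beta>: "(\<lambda>l. \<beta> y l t) \<in> M \<rightarrow>\<^sub>M count_space {-1, 1}" if "y \<in> {1..N}" "t \<in> {1..2 ^ c}" for y t
    using strat that by (auto simp: one_way_strategy_def)
  have Ts: "T x l \<in> {1..2 ^ c}" and \<alpha>s: "\<alpha> x l \<in> {-1, 1}" if "x \<in> {1..N}" "l \<in> space M" for x l
    using measurable_space[OF T[OF that(1)] that(2)] measurable_space[OF \<alpha>[OF that(1)] that(2)] by auto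
  have \<beta>s: "\<beta> y l t \<in> {-1, 1}" if "y \<in> {1..N}" "t \<in> {1..2 ^ c}" "l \<in> space M" for y t l
    using measurable_space[OF \<beta>[OF that(1,2)] that(3)] by auto
  have int: "integrable M (\<lambda>l. \<alpha> x l * \<beta> y l (T x l))" if xy: "x \<in> {1..N}" "y \<in> {1..N}" for x y
  proof (rule integrable_const_bound[where B = 1])
    have "\<bar>\<alpha> x l * \<beta> y l (T x l)\<bar> \<le> 1" if "l \<in> space M" for l
      using \<alpha>s[OF xy(1) that] \<beta>s[OF xy(2) Ts[OF xy(1) that] that] by (auto simp: abs_mult)
    then show "AE l in M. norm (\<alpha> x l * \<beta> y l (T x l)) \<le> 1" by simp
    have a: "\<alpha> x \<in> borel_measurable M"
      using measurable_compose[OF \<alpha>[OF xy(1)] borel_measurable_count_space[of "\<lambda>s. s"]] by simp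
    have b: "(\<lambda>l. \<beta> y l t) \<in> borel_measurable M" if "t \<in> {1..2 ^ c}" for t
      using measurable_compose[OF \<beta>[OF xy(2) that] borel_measurable_count_space[of "\<lambda>s. s"]] by simp
    have i: "(\<lambda>l. if T x l = t then 1 else 0 :: real) \<in> borel_measurable M" for t
      using measurable_compose[OF T[OF xy(1)] borel_measurable_count_space[of "\<lambda>s. if s = t then 1 else 0"]]
      by simp
    \<comment> \<open>Measurability of Bob's answer at a random message follows by summing over the
      finitely many messages.\<close>
    have "(\<lambda>l. \<Sum>t\<in>{1..2 ^ c}. (if T x l = t then 1 else 0) * (\<alpha> x l * \<beta> y l t)) \<in> borel_measurable M"
      by (intro borel_measurable_sum borel_measurable_times a b i)
    also have "?this \<longleftrightarrow> (\<lambda>l. \<alpha> x l * \<beta> y l (T x l)) \<in> borel_measurable M"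
    proof (rule measurable_cong)
      fix l assume "l \<in> space M"
      then have "T x l \<in> {1..2 ^ c}" using Ts xy by blast
      then show "(\<Sum>t\<in>{1..2 ^ c}. (if T x l = t then 1 else 0) * (\<alpha> x l * \<beta> y l t)) = \<alpha> x l * \<beta> y l (T x l)"
        by (simp add: if_distrib[of "\<lambda>s. s * _"] cong: if_cong)
    qed
    finally show "(\<lambda>l. \<alpha> x l * \<beta> y l (T x l)) \<in> borel_measurable M" .
  qed
  have "one_way_payoff N G M T \<alpha> \<beta>
      = (\<integral>l. (\<Sum>x\<in>{1..N}. \<Sum>y\<in>{1..N}. G x y * (\<alpha> x l * \<beta> y l (T x l))) \<partial>M)"
    unfolding one_way_payoff_def
    by (subst Bochner_Integration.integral_sum, intro Bochner_Integration.integrable_sum integrable_mult_right int,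
        assumption, assumption, intro sum.cong refl, subst Bochner_Integration.integral_sum)
       (auto intro!: integrable_mult_right int)
  also have "\<dots> \<le> B"
  proof (rule integral_le_const)
    show "integrable M (\<lambda>l. \<Sum>x\<in>{1..N}. \<Sum>y\<in>{1..N}. G x y * (\<alpha> x l * \<beta> y l (T x l)))"
      by (intro Bochner_Integration.integrable_sum integrable_mult_right int)
    have "(\<Sum>x\<in>{1..N}. \<Sum>y\<in>{1..N}. G x y * (\<alpha> x l * \<beta> y l (T x l))) \<le> B" if "l \<in> space M" for l
      using det[of "\<lambda>x. T x l" "\<lambda>x. \<alpha> x l" "\<lambda>y. \<beta> y l"] Ts \<alpha>s \<beta>s that
      unfolding deterministic_strategy_def deterministic_payoff_def by blast
    then show "AE l in M. (\<Sum>x\<in>{1..N}. \<Sum>y\<in>{1..N}. G x y * (\<alpha> x l * \<beta> y l (T x l))) \<le> B" by simp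
  qed
  finally show ?thesis .
qed

lemma deterministic_payoff_mem:
  assumes strat: "deterministic_strategy c N T \<alpha> \<beta>"
  shows "deterministic_payoff N G T \<alpha> \<beta> \<in>
     {one_way_payoff N G M T \<alpha> \<beta> | (M :: real measure) T \<alpha> \<beta>. one_way_strategy c N M T \<alpha> \<beta>}"
proof -
  \<comment> \<open>A point mass turns a deterministic strategy into a randomised one over the
    required type.\<close>
  let ?M = "return (count_space UNIV) (0::real)"
  interpret prob_space ?M by (rule prob_space_return) simp
  have "one_way_strategy c N ?M (\<lambda>x _. T x) (\<lambda>x _. \<alpha> x) (\<lambda>y _ t. \<beta> y t)"
    unfolding one_way_strategy_def
  proof (intro conjI ballI measurable_const)
    show "prob_space ?M" by (rule prob_space_axioms)
  qed (use strat in \<open>simp_all add: deterministic_strategy_def\<close>)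
  moreover have "one_way_payoff N G ?M (\<lambda>x _. T x) (\<lambda>x _. \<alpha> x) (\<lambda>y _ t. \<beta> y t)
      = deterministic_payoff N G T \<alpha> \<beta>"
    by (simp add: one_way_payoff_def deterministic_payoff_def prob_space[simplified])
  ultimately show ?thesis by (intro CollectI) metis
qed

lemma one_way_value_le:
  assumes N: "1 \<le> N"
  shows "one_way_value c N G \<le> KG * 2 powr (real c / 2) * classical_value N G"
  unfolding one_way_value_def
proof (rule cSup_least)
  show "{one_way_payoff N G M T \<alpha> \<beta> | (M :: real measure) T \<alpha> \<beta>. one_way_strategy c N M T \<alpha> \<beta>} \<noteq> {}"
    using deterministic_payoff_mem[of c N "\<lambda>_. 1" "\<lambda>_. 1" "\<lambda>_ _. 1" G]
    by (auto simp: deterministic_strategy_def)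
qed (auto intro!: one_way_payoff_le deterministic_payoff_le[OF N])

text \<open>The upper bound on payoffs supplies the boundedness that a real supremum needs to
  dominate its members.\<close>

lemma deterministic_payoff_le_one_way_value:
  assumes N: "1 \<le> N"
    and "deterministic_strategy c N T \<alpha> \<beta>"
  shows "deterministic_payoff N G T \<alpha> \<beta> \<le> one_way_value c N G"
  unfolding one_way_value_def
  by (rule cSup_upper[OF deterministic_payoff_mem[OF assms(2)]], rule bdd_aboveI)
     (auto intro!: one_way_payoff_le deterministic_payoff_le[OF N])

section \<open>Lower bounds on the one-way value\<close>

lemma is_xor_gameE:
  assumes "is_xor_game N G"
  obtains f p where "\<And>x y. x \<in> {1..N} \<Longrightarrow> y \<in> {1..N} \<Longrightarrow> f x y \<in> {-1, 1}"
    "set_pmf p \<subseteq> {1..N} \<times> {1..N}" "G = (\<lambda>x y. pmf p (x, y) * f x y)" "1 \<le> N"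
proof -
  from assms obtain f :: "nat \<Rightarrow> nat \<Rightarrow> real" and p :: "(nat \<times> nat) pmf"
    where *: "\<forall>x\<in>{1..N}. \<forall>y\<in>{1..N}. f x y \<in> {-1, 1}" "set_pmf p \<subseteq> {1..N} \<times> {1..N}"
      "G = (\<lambda>x y. pmf p (x, y) * f x y)" unfolding is_xor_game_def by blast
  \<comment> \<open>A probability mass function has nonempty support, so no game has
    \<open>N = 0\<close>.\<close>
  have "{1..N} \<noteq> {}" using *(2) set_pmf_not_empty[of p] by auto
  then have "1 \<le> N" by simp
  then show ?thesis using * by (intro that[of f p]) blast+
qed

lemma sum_pmf_square:
  assumes "set_pmf p \<subseteq> {1..N} \<times> {1..N :: nat}"
  shows "(\<Sum>x\<in>{1..N}. \<Sum>y\<in>{1..N}. pmf p (x, y)) = 1"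
  using sum_pmf_eq_1[OF _ assms] by (simp add: sum.cartesian_product case_prod_unfold)

text \<open>Every input of Alice that carries mass fits into the message, so Bob can always answer
  \<open>f x y\<close>. Separating \<open>n\<close> from \<open>N\<close> covers games supported on
  fewer inputs.\<close>

lemma one_way_value_ge_1:
  assumes f: "\<And>x y. x \<in> {1..N} \<Longrightarrow> y \<in> {1..N} \<Longrightarrow> f x y \<in> {-1, 1}"
    and p: "set_pmf p \<subseteq> {1..n} \<times> {1..N}" and n: "n \<le> N" "n \<le> 2 ^ c" and N: "1 \<le> N"
  shows "1 \<le> one_way_value c N (\<lambda>x y. pmf p (x, y) * f x y)"
proof -
  \<comment> \<open>The default values 1 only keep the strategy legal: inputs above
    \<open>2 ^ c\<close> exceed \<open>n\<close> and have probability 0.\<close>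
  define T :: "nat \<Rightarrow> nat" where "T x = (if x \<le> 2 ^ c then x else 1)" for x
  define \<beta> where "\<beta> y t = (if t \<le> N then f t y else 1)" for y t
  have strat: "deterministic_strategy c N T (\<lambda>_. 1) \<beta>"
    using f by (auto simp: deterministic_strategy_def T_def \<beta>_def)
  have "deterministic_payoff N (\<lambda>x y. pmf p (x, y) * f x y) T (\<lambda>_. 1) \<beta>
      = (\<Sum>x\<in>{1..N}. \<Sum>y\<in>{1..N}. pmf p (x, y))"
    unfolding deterministic_payoff_def
  proof (intro sum.cong refl)
    fix x y assume xy: "x \<in> {1..N}" "y \<in> {1..N}"
    show "pmf p (x, y) * f x y * (1 * \<beta> y (T x)) = pmf p (x, y)"
    proof (cases "x \<le> n")
      case True
      then have "T x = x" using n by (simp add: T_def)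
      then show ?thesis using f[OF xy] xy by (auto simp: \<beta>_def)
    next
      case False
      then have "pmf p (x, y) = 0" using p by (auto simp: pmf_eq_0_set_pmf)
      then show ?thesis by simp
    qed
  qed
  also have "\<dots> = 1" using p n by (intro sum_pmf_square) auto
  finally show ?thesis
    using deterministic_payoff_le_one_way_value[OF N strat, of "\<lambda>x y. pmf p (x, y) * f x y"] by simp
qed

text \<open>
  Alice's inputs are split cyclically, after a random shift, into \<open>2\<^sup>c\<close> blocks of nearly equal size.
  Alice sends the block and outputs a random sign, and Bob outputs the majority of his optimal
  answers for the inputs in the block.
\<close>

lemma one_way_value_ge_balanced:
  assumes f: "\<And>x y. x \<in> {1..N} \<Longrightarrow> y \<in> {1..N} \<Longrightarrow> f x y \<in> {-1, 1}"
    and p: "set_pmf p \<subseteq> {1..N} \<times> {1..N}" and N: "1 \<le> N" and c: "2 ^ c \<le> N"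
  shows "sqrt (2 ^ c / (2 * real N)) \<le> one_way_value c N (\<lambda>x y. pmf p (x, y) * f x y)"
    (is "_ \<le> ?V")
proof -
  define m where "m = (2::nat) ^ c"
  have m: "0 < m" "m \<le> N" using c by (auto simp: m_def)
  \<comment> \<open>The random shift \<open>s\<close> acts modulo \<open>N\<close> before reduction
    to blocks. The final \<open>+ 1\<close> makes messages start at 1.\<close>
  define T where "T s x = (x + s) mod N mod m + 1" for s x
  define B where "B s t = {z \<in> {1..N}. T s z = t}" for s t
  define \<beta> where "\<beta> s A y t = sg (\<Sum>z\<in>B s t. f z y * sgnf A z)" for s A y t
  define G where "G x y = pmf p (x, y) * f x y" for x y
  define S where "S = (\<Sum>z<N. majority_corr (card {z'. z' < N \<and> z' mod m = z mod m} - 1))"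
  have inj: "inj_on (\<lambda>s. (x + s) mod N) {..<N}" for x
  proof (rule inj_onI)
    have le: "s' \<le> s" if "s < N" "s' < N" "(x + s) mod N = (x + s') mod N" for s s'
    proof (rule ccontr)
      assume "\<not> s' \<le> s"
      then have "N dvd s' - s"
        using that(3) mod_eq_dvd_iff_nat[of "x + s" "x + s'" N] by simp
      then show False using \<open>\<not> s' \<le> s\<close> that(2) by (auto dest: dvd_imp_le)
    qed
    fix s s' assume "s \<in> {..<N}" "s' \<in> {..<N}" "(x + s) mod N = (x + s') mod N"
    then show "s = s'" using le[of s s'] le[of s' s] by simp
  qed
  have img: "(\<lambda>s. (x + s) mod N) ` {..<N} = {..<N}" for x
    using N by (intro card_subset_eq) (auto simp: card_image[OF inj])
  have bij: "bij_betw (\<lambda>s. (x + s) mod N) {..<N} {..<N}" for x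
    using inj img by (simp add: bij_betw_def)
  have bij': "bij_betw (\<lambda>z. (z + s) mod N) {1..N} {..<N}" for s
  proof -
    have "bij_betw (\<lambda>i. i - 1) {1..N} {..<N}"
      by (rule bij_betw_byWitness[where f' = Suc]) auto
    from bij_betw_trans[OF this bij[of "Suc s"]]
    have "bij_betw ((\<lambda>i. (Suc s + i) mod N) \<circ> (\<lambda>i. i - 1)) {1..N} {..<N}" .
    then show ?thesis
      by (rule bij_betw_cong[THEN iffD1, rotated]) (auto simp: add.commute)
  qed
  have cardB: "card (B s (T s x)) = card {z'. z' < N \<and> z' mod m = (x + s) mod N mod m}" for s x
  proof -
    have "bij_betw (\<lambda>z. (z + s) mod N) (B s (T s x)) {z'. z' < N \<and> z' mod m = (x + s) mod N mod m}"
    proof (rule bij_betw_subset[OF bij'])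
      have "{z'. z' < N \<and> z' mod m = (x + s) mod N mod m}
          = {z' \<in> (\<lambda>z. (z + s) mod N) ` {1..N}. z' mod m = (x + s) mod N mod m}"
        unfolding bij_betw_imp_surj_on[OF bij'] by auto
      also have "\<dots> = (\<lambda>z. (z + s) mod N) ` B s (T s x)"
        unfolding B_def T_def by auto
      finally show "(\<lambda>z. (z + s) mod N) ` B s (T s x)
          = {z'. z' < N \<and> z' mod m = (x + s) mod N mod m}" ..
    qed (auto simp: B_def)
    then show ?thesis by (rule bij_betw_same_card)
  qed
  \<comment> \<open>The shift moves \<open>x\<close> uniformly over all positions, so the total is
    the same for every pair of questions. This makes the strategy work against every
    distribution.\<close>
  have corr: "(\<Sum>s<N. \<Sum>A\<in>Pow {1..N}. f x y * sgnf A x * \<beta> s A y (T s x)) = 2 ^ N * S"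
    if xy: "x \<in> {1..N}" "y \<in> {1..N}" for x y
  proof -
    have "(\<Sum>A\<in>Pow {1..N}. f x y * sgnf A x * \<beta> s A y (T s x))
        = 2 ^ N * majority_corr (card (B s (T s x)) - 1)" for s
      unfolding \<beta>_def
      by (subst majority_correlation) (use xy f in \<open>auto simp: B_def\<close>)
    then have "(\<Sum>s<N. \<Sum>A\<in>Pow {1..N}. f x y * sgnf A x * \<beta> s A y (T s x))
        = 2 ^ N * (\<Sum>s<N. majority_corr (card {z'. z' < N \<and> z' mod m = (x + s) mod N mod m} - 1))"
      by (simp add: cardB sum_distrib_left)
    also have "(\<Sum>s<N. majority_corr (card {z'. z' < N \<and> z' mod m = (x + s) mod N mod m} - 1)) = S"
      unfolding S_def by (rule sum.reindex_bij_betw[OF bij])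
    finally show ?thesis .
  qed
  have strat: "deterministic_strategy c N (T s) (sgnf A) (\<beta> s A)" for s A
  proof -
    have "T s x \<in> {1..2 ^ c}" for x
      using m mod_less_divisor[OF m(1), of "(x + s) mod N"] by (simp add: T_def m_def Suc_le_eq)
    moreover have "sgnf A x \<in> {-1, 1}" for x by (simp add: sgnf_def)
    ultimately show ?thesis unfolding deterministic_strategy_def \<beta>_def by (meson sg_values)
  qed
  have "2 ^ N * S = (\<Sum>x\<in>{1..N}. \<Sum>y\<in>{1..N}. pmf p (x, y) * (2 ^ N * S))"
    using sum_pmf_square[OF p] by (simp flip: sum_distrib_right)
  also have "\<dots> = (\<Sum>x\<in>{1..N}. \<Sum>y\<in>{1..N}. \<Sum>s<N. \<Sum>A\<in>Pow {1..N}. G x y * (sgnf A x * \<beta> s A y (T s x)))"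
  proof (rule sum.cong[OF refl], rule sum.cong[OF refl])
    fix x y assume "x \<in> {1..N}" "y \<in> {1..N}"
    from corr[OF this, symmetric]
    show "pmf p (x, y) * (2 ^ N * S) = (\<Sum>s<N. \<Sum>A\<in>Pow {1..N}. G x y * (sgnf A x * \<beta> s A y (T s x)))"
      by (simp add: G_def sum_distrib_left mult.assoc)
  qed
  also have "\<dots> = (\<Sum>x\<in>{1..N}. \<Sum>s<N. \<Sum>y\<in>{1..N}. \<Sum>A\<in>Pow {1..N}. G x y * (sgnf A x * \<beta> s A y (T s x)))"
    by (rule sum.cong[OF refl sum.swap])
  also have "\<dots> = (\<Sum>s<N. \<Sum>x\<in>{1..N}. \<Sum>y\<in>{1..N}. \<Sum>A\<in>Pow {1..N}. G x y * (sgnf A x * \<beta> s A y (T s x)))"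
    by (rule sum.swap)
  also have "\<dots> = (\<Sum>s<N. \<Sum>x\<in>{1..N}. \<Sum>A\<in>Pow {1..N}. \<Sum>y\<in>{1..N}. G x y * (sgnf A x * \<beta> s A y (T s x)))"
    by (rule sum.cong[OF refl], rule sum.cong[OF refl sum.swap])
  also have "\<dots> = (\<Sum>s<N. \<Sum>A\<in>Pow {1..N}. \<Sum>x\<in>{1..N}. \<Sum>y\<in>{1..N}. G x y * (sgnf A x * \<beta> s A y (T s x)))"
    by (rule sum.cong[OF refl sum.swap])
  \<comment> \<open>Each choice of shift and signs is a deterministic strategy, so the average
    payoff is at most the value.\<close>
  also have "\<dots> \<le> (\<Sum>s<N. \<Sum>A\<in>Pow {1..N}. ?V)"
    using deterministic_payoff_le_one_way_value[OF N strat, of G]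
    unfolding deterministic_payoff_def G_def[abs_def] by (intro sum_mono)
  also have "\<dots> = 2 ^ N * (real N * ?V)" by (simp add: card_Pow)
  finally have "S \<le> real N * ?V" by simp
  moreover have "sqrt (real m * real N / 2) \<le> S"
    unfolding S_def by (rule sum_majority_blocks_ge[OF m])
  moreover have "sqrt (real m * real N / 2) = real N * sqrt (2 ^ c / (2 * real N))"
  proof -
    have "real m * real N / 2 = (real N)\<^sup>2 * (2 ^ c / (2 * real N))"
      using N by (simp add: m_def power2_eq_square field_simps)
    then show ?thesis by (simp only: real_sqrt_mult) simp
  qed
  ultimately have "real N * sqrt (2 ^ c / (2 * real N)) \<le> real N * ?V" by linarith
  then show ?thesis using N by simp
qed

text \<open>If \<open>2 ^ c \<le> N\<close>, then \<open>sqrt 2 \<le> KG\<close> absorbs the factor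
  lost by the balanced blocks. Otherwise the value is at least 1, and the regime hypothesis bounds
  the left side by 1.\<close>

lemma one_way_value_ge:
  assumes G: "is_xor_game N G" and "nontrivial_regime c N"
  shows "2 powr (real c / 2) / (KG * sqrt (real N)) \<le> one_way_value c N G"
proof -
  obtain f p where f: "\<And>x y. x \<in> {1..N} \<Longrightarrow> y \<in> {1..N} \<Longrightarrow> f x y \<in> {-1, 1}"
    and p: "set_pmf p \<subseteq> {1..N} \<times> {1..N}" and G: "G = (\<lambda>x y. pmf p (x, y) * f x y)" and N: "1 \<le> N"
    by (rule is_xor_gameE[OF G]) (rule that)
  show ?thesis
  proof (cases "2 ^ c \<le> N")
    case True
    have "2 powr (real c / 2) / (KG * sqrt (real N)) \<le> 2 powr (real c / 2) / (sqrt 2 * sqrt (real N))"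
      using KG_ge_sqrt2 N by (intro divide_left_mono mult_right_mono mult_pos_pos KG_pos) auto
    also have "\<dots> = sqrt (2 ^ c / (2 * real N))"
      by (simp add: two_powr_half real_sqrt_divide real_sqrt_mult)
    also have "\<dots> \<le> one_way_value c N G"
      unfolding G by (rule one_way_value_ge_balanced[OF f p N True])
    finally show ?thesis .
  next
    case False
    then have "1 \<le> one_way_value c N G"
      unfolding G by (intro one_way_value_ge_1[OF f p]) (use N in auto)
    then show ?thesis using assms(2) by (simp add: nontrivial_regime_def)
  qed
qed

subsection \<open>Walsh matrices\<close>

text \<open>Sylvester's Hadamard matrices: for indices below \<open>2 ^ k\<close> the sign is -1 to
  the number of binary ones common to \<open>x\<close> and \<open>y\<close>. The recursion strips
  the leading bit.\<close>

fun walsh :: "nat \<Rightarrow> nat \<Rightarrow> nat \<Rightarrow> real" where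
  "walsh 0 x y = 1"
| "walsh (Suc k) x y = (if 2 ^ k \<le> x \<and> 2 ^ k \<le> y then -1 else 1) * walsh k (x mod 2 ^ k) (y mod 2 ^ k)"

lemma walsh_values: "walsh k x y \<in> {-1, 1}"
  by (induction k arbitrary: x y) auto

lemma sum_lessThan_double:
  fixes g :: "nat \<Rightarrow> real"
  shows "(\<Sum>x<2 * n. g x) = (\<Sum>x<n. g x) + (\<Sum>x<n. g (n + x))"
proof -
  have "(\<Sum>x<m + n. g x) = (\<Sum>x<m. g x) + (\<Sum>x<n. g (m + x))" for m n
    by (induction n) auto
  then show ?thesis by (simp add: mult_2)
qed

lemma walsh_isometry:
  "(\<Sum>x<2 ^ k. (\<Sum>y<2 ^ k. walsh k x y * b y)\<^sup>2) = 2 ^ k * (\<Sum>y<2 ^ k. (b y)\<^sup>2)"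
proof (induction k arbitrary: b)
  case (Suc k)
  let ?n = "(2::nat) ^ k"
  \<comment> \<open>\<open>p\<close> and \<open>q\<close> transform the two halves of
    \<open>b\<close>. The two halves of the full transform are their sum and difference, and the
    parallelogram law closes the induction.\<close>
  define p where "p x = (\<Sum>y<?n. walsh k x y * b y)" for x
  define q where "q x = (\<Sum>y<?n. walsh k x y * b (?n + y))" for x
  have 1: "(\<Sum>y<2 ^ Suc k. walsh (Suc k) x y * b y) = p x + q x" if "x < ?n" for x
    using that unfolding power_Suc sum_lessThan_double p_def q_def
    by (intro arg_cong2[of _ _ _ _ "(+)"] sum.cong) auto
  have 2: "(\<Sum>y<2 ^ Suc k. walsh (Suc k) (?n + x) y * b y) = p x - q x" if "x < ?n" for x
    using that unfolding power_Suc sum_lessThan_double p_def q_def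
    by (auto simp: sum_negf intro!: sum.cong)
  have "(\<Sum>x<2 ^ Suc k. (\<Sum>y<2 ^ Suc k. walsh (Suc k) x y * b y)\<^sup>2)
      = (\<Sum>x<?n. (p x + q x)\<^sup>2) + (\<Sum>x<?n. (p x - q x)\<^sup>2)"
  proof -
    define R where "R x = (\<Sum>y<2 ^ Suc k. walsh (Suc k) x y * b y)" for x
    have "(\<Sum>x<2 ^ Suc k. (R x)\<^sup>2) = (\<Sum>x<?n. (R x)\<^sup>2) + (\<Sum>x<?n. (R (?n + x))\<^sup>2)"
      unfolding power_Suc by (rule sum_lessThan_double)
    also have "\<dots> = (\<Sum>x<?n. (p x + q x)\<^sup>2) + (\<Sum>x<?n. (p x - q x)\<^sup>2)"
      using 1 2 unfolding R_def by (intro arg_cong2[of _ _ _ _ "(+)"] sum.cong) auto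
    finally show ?thesis unfolding R_def .
  qed
  also have "\<dots> = 2 * (\<Sum>x<?n. (p x)\<^sup>2) + 2 * (\<Sum>x<?n. (q x)\<^sup>2)"
    unfolding sum.distrib[symmetric] sum_distrib_left
    by (intro sum.cong) (auto simp: power2_eq_square algebra_simps)
  also have "(\<Sum>x<?n. (p x)\<^sup>2) = 2 ^ k * (\<Sum>y<?n. (b y)\<^sup>2)" unfolding p_def by (rule Suc.IH)
  also have "(\<Sum>x<?n. (q x)\<^sup>2) = 2 ^ k * (\<Sum>y<?n. (b (?n + y))\<^sup>2)" unfolding q_def by (rule Suc.IH)
  also have "2 * (2 ^ k * (\<Sum>y<?n. (b y)\<^sup>2)) + 2 * (2 ^ k * (\<Sum>y<?n. (b (?n + y))\<^sup>2))
      = 2 ^ Suc k * (\<Sum>y<2 ^ Suc k. (b y)\<^sup>2)"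
    by (simp add: sum_lessThan_double algebra_simps)
  finally show ?case .
qed simp

text \<open>Cauchy-Schwarz with \<open>walsh_isometry\<close>: both sign vectors and the operator
  contribute a factor \<open>sqrt (2 ^ k)\<close>.\<close>

lemma walsh_bilinear_le:
  assumes "\<And>x. x < 2 ^ k \<Longrightarrow> a x \<in> {-1, 1}" "\<And>y. y < 2 ^ k \<Longrightarrow> b y \<in> {-1, 1}"
  shows "(\<Sum>x<2 ^ k. \<Sum>y<2 ^ k. walsh k x y * a x * b y) \<le> 2 ^ k * sqrt (2 ^ k)"
proof -
  have 1: "(\<Sum>x<(2::nat) ^ k. (s x)\<^sup>2) = 2 ^ k" if "\<And>x. x < 2 ^ k \<Longrightarrow> s x \<in> {-1, 1}" for s :: "nat \<Rightarrow> real"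
  proof -
    have "(\<Sum>x<(2::nat) ^ k. (s x)\<^sup>2) = (\<Sum>x<(2::nat) ^ k. 1)"
      using that by (intro sum.cong refl) (auto simp: power2_eq_1_iff)
    then show ?thesis by simp
  qed
  have "(\<Sum>x<2 ^ k. \<Sum>y<2 ^ k. walsh k x y * a x * b y)
      = (\<Sum>x<2 ^ k. a x * (\<Sum>y<2 ^ k. walsh k x y * b y))"
    by (simp add: sum_distrib_left mult_ac)
  also have "\<dots> \<le> sqrt ((\<Sum>x<2 ^ k. (a x)\<^sup>2) * (\<Sum>x<2 ^ k. (\<Sum>y<2 ^ k. walsh k x y * b y)\<^sup>2))"
    by (intro real_le_rsqrt Cauchy_Schwarz_ineq_sum)
  also have "\<dots> = sqrt ((2 ^ k)\<^sup>2 * 2 ^ k)"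
  proof -
    have "(\<Sum>x<(2::nat) ^ k. (a x)\<^sup>2) = 2 ^ k" "(\<Sum>y<(2::nat) ^ k. (b y)\<^sup>2) = 2 ^ k"
      using assms by (auto intro: 1)
    then show ?thesis unfolding walsh_isometry by (simp only: power2_eq_square mult.assoc)
  qed
  also have "\<dots> = 2 ^ k * sqrt (2 ^ k)"
    unfolding real_sqrt_mult by simp
  finally show ?thesis .
qed

text \<open>The uniform law on the leading square pads the matrix by zeros, so one game serves every
  \<open>N \<ge> 2 ^ k\<close>. Subtracting 1 converts inputs to indices from 0.\<close>

definition walsh_game :: "nat \<Rightarrow> nat \<Rightarrow> nat \<Rightarrow> real" where
  "walsh_game k x y =
     pmf (pmf_of_set ({1..2 ^ k} \<times> {1..2 ^ k})) (x, y) * walsh k (x - 1) (y - 1)"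

lemma is_xor_game_walsh_game:
  assumes "2 ^ k \<le> N"
  shows "is_xor_game N (walsh_game k)"
  unfolding is_xor_game_def
proof (intro exI conjI)
  show "walsh_game k = (\<lambda>x y. pmf (pmf_of_set ({1..2 ^ k} \<times> {1..2 ^ k})) (x, y) * walsh k (x - 1) (y - 1))"
    by (simp add: walsh_game_def fun_eq_iff)
qed (use assms walsh_values in \<open>auto simp: set_pmf_of_set\<close>)

lemma classical_value_walsh_game:
  assumes k: "2 ^ k \<le> N"
  shows "classical_value N (walsh_game k) \<le> 1 / sqrt (2 ^ k)"
proof (rule classical_value_le)
  fix a b :: "nat \<Rightarrow> real"
  assume a: "\<And>x. x \<in> {1..N} \<Longrightarrow> a x \<in> {-1, 1}" and b: "\<And>y. y \<in> {1..N} \<Longrightarrow> b y \<in> {-1, 1}"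
  let ?n = "(2::nat) ^ k"
  have w: "walsh_game k x y = (if x \<in> {1..?n} \<and> y \<in> {1..?n} then walsh k (x - 1) (y - 1) / 4 ^ k else 0)" for x y
    by (simp add: walsh_game_def pmf_of_set indicator_def power_mult_distrib[symmetric])
  have "(\<Sum>x\<in>{1..N}. \<Sum>y\<in>{1..N}. walsh_game k x y * a x * b y)
      = (\<Sum>x\<in>{1..N}. \<Sum>y\<in>{1..?n}. walsh_game k x y * a x * b y)"
    using k by (intro sum.cong refl sum.mono_neutral_right) (auto simp: w)
  also have "\<dots> = (\<Sum>x\<in>{1..?n}. \<Sum>y\<in>{1..?n}. walsh_game k x y * a x * b y)"
    using k by (intro sum.mono_neutral_right) (auto simp: w)
  also have "\<dots> = (\<Sum>x\<in>{1..?n}. \<Sum>y\<in>{1..?n}. walsh k (x - 1) (y - 1) * a x * b y) / 4 ^ k"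
    by (simp add: w sum_divide_distrib)
  also have "(\<Sum>x\<in>{1..?n}. \<Sum>y\<in>{1..?n}. walsh k (x - 1) (y - 1) * a x * b y)
      = (\<Sum>x<?n. \<Sum>y<?n. walsh k x y * a (Suc x) * b (Suc y))"
    by (simp add: sum.atLeast1_atMost_eq)
  also have "\<dots> \<le> 2 ^ k * sqrt (2 ^ k)"
    by (rule walsh_bilinear_le) (use a b k in auto)
  also have "2 ^ k * sqrt (2 ^ k) / 4 ^ k = 1 / sqrt (2 ^ k)"
  proof -
    have "(4::real) ^ k = 2 ^ k * 2 ^ k" by (simp flip: power_mult_distrib)
    then show ?thesis by (simp add: divide_simps)
  qed
  finally show "(\<Sum>x\<in>{1..N}. \<Sum>y\<in>{1..N}. walsh_game k x y * a x * b y) \<le> 1 / sqrt (2 ^ k)"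
    by (simp add: divide_right_mono)
qed

lemma one_way_value_walsh_game_ge:
  assumes "k \<le> c" "2 ^ k \<le> N"
  shows "1 \<le> one_way_value c N (walsh_game k)"
proof -
  have "1 \<le> one_way_value c N (\<lambda>x y. pmf (pmf_of_set ({1..2 ^ k} \<times> {1..2 ^ k})) (x, y) * walsh k (x - 1) (y - 1))"
    using assms order_trans[OF one_le_power[of 2 k] assms(2)]
    by (intro one_way_value_ge_1[where n = "2 ^ k"] walsh_values) (auto simp: set_pmf_of_set)
  then show ?thesis by (simp add: walsh_game_def[abs_def])
qed

theorem theorem1p2:
  "(\<forall>N c G. is_xor_game N G \<longrightarrow>
      one_way_value c N G \<le> KG * 2 powr (real c / 2) * classical_value N G) \<and>
   (\<forall>N c G. is_xor_game N G \<longrightarrow> nontrivial_regime c N \<longrightarrow>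
      one_way_value c N G \<ge> 2 powr (real c / 2) / (KG * sqrt (real N))) \<and>
   (\<exists>A B :: real. 0 < A \<and> 0 < B \<and>
      (\<forall>N c. 1 \<le> N \<longrightarrow> nontrivial_regime c N \<longrightarrow>
         (\<exists>J H. is_xor_game N J \<and> is_xor_game N H \<and>
            A * (2 powr (real c / 2) * classical_value N J) \<le> one_way_value c N J \<and>
            one_way_value c N J \<le> B * (2 powr (real c / 2) * classical_value N J) \<and>
            A * (2 powr (real c / 2) / sqrt (real N)) \<le> one_way_value c N H \<and>
            one_way_value c N H \<le> B * (2 powr (real c / 2) / sqrt (real N)))))"
proof (intro conjI)
  show upper: "\<forall>N c G. is_xor_game N G \<longrightarrow>
      one_way_value c N G \<le> KG * 2 powr (real c / 2) * classical_value N G"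
    by (auto elim!: is_xor_gameE intro: one_way_value_le)
  show lower: "\<forall>N c G. is_xor_game N G \<longrightarrow> nontrivial_regime c N \<longrightarrow>
      one_way_value c N G \<ge> 2 powr (real c / 2) / (KG * sqrt (real N))"
    using one_way_value_ge by blast
  have KG1: "1 \<le> KG" using KG_ge_sqrt2 by (rule order_trans[rotated]) simp
  show "\<exists>A B :: real. 0 < A \<and> 0 < B \<and>
      (\<forall>N c. 1 \<le> N \<longrightarrow> nontrivial_regime c N \<longrightarrow>
         (\<exists>J H. is_xor_game N J \<and> is_xor_game N H \<and>
            A * (2 powr (real c / 2) * classical_value N J) \<le> one_way_value c N J \<and>
            one_way_value c N J \<le> B * (2 powr (real c / 2) * classical_value N J) \<and>
            A * (2 powr (real c / 2) / sqrt (real N)) \<le> one_way_value c N H \<and>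
            one_way_value c N H \<le> B * (2 powr (real c / 2) / sqrt (real N))))"
  proof (rule exI[of _ "1 / (2 * KG)"], rule exI[of _ "2 * KG"], intro conjI allI impI)
    show "0 < 1 / (2 * KG)" "0 < 2 * KG" using KG_pos by auto
    fix N c :: nat assume N: "1 \<le> N" and reg: "nontrivial_regime c N"
    let ?C = "2 powr (real c / 2)"
    \<comment> \<open>\<open>2 ^ K\<close> is the largest Walsh size fitting into \<open>N\<close>
      inputs and serves for \<open>H\<close>. For \<open>J\<close> the size is also capped by
      \<open>2 ^ c\<close>, so that the message reveals Alice's input.\<close>
    obtain K where K: "2 ^ K \<le> N" "N < 2 ^ (K + 1)" using ex_power_ivl1[of 2 N] N by auto
    define k where "k = min c K"
    have "(2::nat) ^ k \<le> 2 ^ K" by (intro power_increasing) (auto simp: k_def)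
    with K(1) have k: "2 ^ k \<le> N" "k \<le> c" by (linarith, simp add: k_def)
    have sN: "sqrt (real N) \<le> 2 * sqrt (2 ^ K)"
    proof -
      \<comment> \<open>The factor 2 from \<open>N < 2 ^ (K + 1)\<close> is rounded up to 4 for the
        sake of its square root.\<close>
      have "real N \<le> 4 * 2 ^ K" using K(2) by (simp add: of_nat_less_iff[symmetric, where 'a = real] del: of_nat_less_iff)
      then have "sqrt (real N) \<le> sqrt (4 * 2 ^ K)" by simp
      then show ?thesis by (simp add: real_sqrt_mult)
    qed
    have C: "?C \<le> KG * sqrt (real N)"
      using reg KG_pos N by (simp add: nontrivial_regime_def divide_le_eq)
    have J: "is_xor_game N (walsh_game k)" and H: "is_xor_game N (walsh_game K)"
      using is_xor_game_walsh_game k K by auto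
    have Jlow: "1 / (2 * KG) * (?C * classical_value N (walsh_game k)) \<le> one_way_value c N (walsh_game k)"
    proof -
      have "?C \<le> 2 * KG * sqrt (2 ^ k)"
      \<comment> \<open>Either the message length limits the Walsh size and \<open>?C\<close> is
        exactly \<open>sqrt (2 ^ k)\<close>, or \<open>N\<close> limits it and the regime hypothesis
        bounds \<open>?C\<close>.\<close>
      proof (cases "c \<le> K")
        case True
        then have "?C = 1 * sqrt (2 ^ k)" by (simp add: k_def two_powr_half)
        also have "\<dots> \<le> 2 * KG * sqrt (2 ^ k)" using KG1 by (intro mult_right_mono) auto
        finally show ?thesis .
      next
        case False
        then have "KG * sqrt (real N) \<le> KG * (2 * sqrt (2 ^ k))"
          using sN KG_pos by (intro mult_left_mono) (auto simp: k_def)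
        with C show ?thesis by simp
      qed
      have "?C * classical_value N (walsh_game k) \<le> ?C * (1 / sqrt (2 ^ k))"
        by (intro mult_left_mono classical_value_walsh_game k) auto
      also have "\<dots> \<le> 2 * KG" using \<open>?C \<le> 2 * KG * sqrt (2 ^ k)\<close> by (simp add: divide_le_eq)
      finally have "1 / (2 * KG) * (?C * classical_value N (walsh_game k)) \<le> 1"
        using KG_pos by (simp add: divide_le_eq)
      also have "\<dots> \<le> one_way_value c N (walsh_game k)" by (rule one_way_value_walsh_game_ge[OF k(2,1)])
      finally show ?thesis .
    qed
    have Jup: "one_way_value c N (walsh_game k) \<le> 2 * KG * (?C * classical_value N (walsh_game k))"
    proof -
      have "0 \<le> classical_value N (walsh_game k)"
        using op_norm_nonneg[OF N] op_norm_le_classical_value[OF N] by (rule order_trans)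
      then have "0 \<le> KG * ?C * classical_value N (walsh_game k)" using KG_pos by simp
      moreover have "one_way_value c N (walsh_game k) \<le> KG * ?C * classical_value N (walsh_game k)"
        using upper J by blast
      ultimately show ?thesis by simp
    qed
    have Hlow: "1 / (2 * KG) * (?C / sqrt (real N)) \<le> one_way_value c N (walsh_game K)"
    proof -
      have "1 / (2 * KG) * (?C / sqrt (real N)) = ?C / (KG * sqrt (real N)) / 2" by simp
      also have "\<dots> \<le> ?C / (KG * sqrt (real N))"
      proof -
        have half: "t / 2 \<le> t" if "0 \<le> t" for t :: real using that by simp
        show ?thesis by (rule half) (use KG_pos in simp)
      qed
      also have "\<dots> \<le> one_way_value c N (walsh_game K)" using lower H reg by blast
      finally show ?thesis .
    qed
    have Hup: "one_way_value c N (walsh_game K) \<le> 2 * KG * (?C / sqrt (real N))"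
    proof -
      \<comment> \<open>The upper bound makes the one-way value small because the classical value is
        at most \<open>1 / sqrt (2 ^ K)\<close>. The matching lower bound holds for any game in the
        regime.\<close>
      have "one_way_value c N (walsh_game K) \<le> KG * ?C * classical_value N (walsh_game K)"
        using upper H by blast
      also have "\<dots> \<le> KG * ?C * (1 / sqrt (2 ^ K))"
        using KG_pos by (intro mult_left_mono classical_value_walsh_game K) auto
      also have "\<dots> \<le> KG * ?C * (2 / sqrt (real N))"
        using KG_pos sN N by (intro mult_left_mono) (auto simp: divide_simps)
      finally show ?thesis by (simp add: mult_ac)
    qed
    show "\<exists>J H. is_xor_game N J \<and> is_xor_game N H \<and>
            1 / (2 * KG) * (?C * classical_value N J) \<le> one_way_value c N J \<and>
            one_way_value c N J \<le> 2 * KG * (?C * classical_value N J) \<and>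
            1 / (2 * KG) * (?C / sqrt (real N)) \<le> one_way_value c N H \<and>
            one_way_value c N H \<le> 2 * KG * (?C / sqrt (real N))"
      using J H Jlow Jup Hlow Hup by blast
  qed
qed

end
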